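(* Let $A$ be a simplicial commutative ring and let $X$ be a filtered $A$-module with filtered $\mathrm S^1$-action. Then, for $i\in\mathbb Z$, there are equivalences $$\mathrm{gr}^i(X^{\mathbb T_{\mathrm{fil}}})\simeq|\mathrm{gr}(X)|^{\ge i}[2i],\qquad \mathrm{gr}^i(X^{\mathrm t\mathbb T_{\mathrm{fil}}})\simeq|\mathrm{gr}(X)|[2i],$$ where $\mathrm{gr}(X)$ is regarded as an $\mathrm h_+$-differential graded $A$-module, $|\mathrm{gr}(X)|$ denotes its cohomology type and $|\mathrm{gr}(X)|^{\ge\star}$ the brutal filtration thereon.
   Context: All categorical notions are $\infty$-categorical. Let $\mathcal C=\mathrm{Mod}_A$ with unit $\mathbb 1=A$. Gradings and filtrations. $\mathrm{Gr}(\mathcal C)=\mathrm{Fun}(\mathbb Z^{\mathrm{disc}},\mathcal C)$, $\mathrm{Fil}(\mathcal C)=\mathrm{Fun}(\mathbb Z^{\mathrm{op}},\mathcal C)$, with Day convolution; $X(n)^m=X^{m-n}$, and objects of $\mathcal C$ are placed in weight/filtration $0$; $\mathrm{gr}^n(X)=\mathrm{cofib}(X^{n+1}\to X^n)$; $X$ is complete if $\lim_{n\to\infty}X^n\simeq0$. Filtered circle. $\mathbb T=\mathbb Z[\mathrm S^1]$ is a bicommutative bialgebra in $\mathrm{Mod}_{\mathbb Z}$. $\mathbb T_{\mathrm{fil}}=\tau_{\ge\star}(\mathbb T)$ (Postnikov filtration) in $\mathrm{Fil}(\mathrm{Mod}_{\mathbb Z})$ has a unique bicommutative bialgebra structure inducing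 that of $\mathbb T$ on colimits; its image in $\mathrm{Fil}(\mathcal C)$ is denoted the same way. A filtered $A$-module with filtered $\mathrm S^1$-action is a $\mathbb T_{\mathrm{fil}}$-module in $\mathrm{Fil}(\mathcal C)$. Fixed points and Tate construction. Let $\mathcal E$ be a stable presentable symmetric monoidal $\infty$-category, $H$ a cocommutative bialgebra in $\mathcal E$ which is dualizable, $\omega$ an invertible object and $\alpha:H^\vee\simeq\omega^{-1}\otimes H$ an equivalence of $H$-$H$-bimodules. For a left $H$-module $X$, set $X_H=\mathbb 1\otimes_HX$ and $X^H=\underline{\mathrm{Map}}_H(\mathbb 1,X)$ (with $\mathbb 1$ an $H$-module via the counit). The dual of the counit is a bimodule map $\eta:\mathbb 1\to H^\vee$, which induces $\omega\otimes(\mathbb 1\otimes_HX)\to\omega\otimes(H^\vee\otimes_HX)\simeq X$; since the source is a trivial module this factors uniquely through a norm map $\mathrm{Nm}_X:\omega\otimes X_H\to X^H$, and $X^{\mathrm tH}:=\mathrm{cofib}(\mathrm{Nm}_X)$. The objects $X^{\mathbb T_{\mathrm{fil}}}$, $X^{\mathrm t\mathbb T_{\mathrm{fil}}}\in\mathrm{Fil}(\mathcal C)$ are these for $\mathcal E=\mathrm{Fil}(\mathcal C)$, $H=\mathbb T_{\mathrm{fil}}$, $\omega=\mathbb 1[1](1)$, where the equivalence $\alpha$ is the Postnikov filtration of the canonical equivalence $\mathbb T^\vee\simeq\mathbb T[-1]$. $\mathrm h_\pm$-dg objects and cohomology type. Let $\mathbb Z[\epsilon]/(\epsilon^2)$ be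 the bicommutative bialgebra in graded abelian groups (Koszul sign rule) with $\epsilon$ primitive in degree $1$. The functor $\{M^n\}\mapsto\{M^n[\pm n]\}$ sends it to a bicommutative bialgebra $\mathbb D_\pm\simeq\mathbb Z\oplus\mathbb Z[\pm1](1)$ in $\mathrm{Gr}(\mathrm{Mod}_{\mathbb Z})$, with image also called $\mathbb D_\pm$ in $\mathrm{Gr}(\mathcal C)$. Set $\mathrm{DG}_\pm(\mathcal C)=\mathrm{Mod}_{\mathbb D_\pm}(\mathrm{Gr}(\mathcal C))$; objects of $\mathrm{DG}_+(\mathrm{Mod}_A)$ are $\mathrm h_+$-dg $A$-modules. As $\mathrm{gr}(\mathbb T_{\mathrm{fil}})\simeq\mathbb D_+$ as bialgebras, $\mathrm{gr}(X)$ is an $\mathrm h_+$-dg $A$-module for $X$ as in the claim. There is a canonical symmetric monoidal equivalence $\overline{\mathrm{gr}}$ from complete filtered objects of $\mathcal C$ to $\mathrm{DG}_-(\mathcal C)$ refining $\mathrm{gr}$ (identify filtered objects with modules over the graded algebra $\mathbb 1[t]$ underlying the filtered unit, so that $\mathrm{gr}$ is $\mathbb 1\otimes_{\mathbb 1[t]}-$, which carries a coaction of $\mathrm{Bar}(\mathbb 1[t])\simeq\mathbb D_-^\vee$). The shift $\{Y^n\}\mapsto\{Y^n[-2n]\}$ is canonically a symmetric monoidal equivalence of $\mathrm{Gr}(\mathcal C)$ carrying $\mathbb D_+$ to $\mathbb D_-$. For $Y\in\mathrm{DG}_+(\mathcal C)$, the brutal filtration is $|Y|^{\ge\star}=\overline{\mathrm{gr}}^{-1}(Y[-2*])$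 and the cohomology type is $|Y|=\mathrm{colim}\,|Y|^{\ge\star}$. *)

theory Defs
  imports "HOL-Algebra.Ring" "HOL-Algebra.RingHom"
    "HOL-Library.Function_Algebras" "HOL-Library.Product_Plus"
begin

text \<open>
  The \<open>\<infinity>\<close>-categories are presented by differential graded models, with homological
  grading (\<open>d\<close> lowers the degree by one). \<open>Mod\<^sub>A\<close> is presented by the dg modules over the
  chain dg ring of \<open>A\<close>, filtered objects by \<open>\<int>\<^sup>o\<^sup>p\<close>-diagrams of dg modules, modules over a
  dg algebra by strict modules; equivalences are spans of quasi-isomorphisms, and cofibres,
  sequential limits and colimits, and bar constructions are the usual homotopy-invariant ones.

  A graded abelian group is a family of additive subgroups of an ambient abelian group.
  This loses no generality, since a family of groups embeds in its direct sum. Operations carry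
  the degree of their argument, as the subgroups in different degrees may overlap.
\<close>

definition ksign :: "int \<Rightarrow> 'm::ab_group_add \<Rightarrow> 'm" where
  "ksign k x = (if even k then x else - x)"

definition add_subgroup :: "'m::ab_group_add set \<Rightarrow> bool" where
  "add_subgroup S \<longleftrightarrow> 0 \<in> S \<and> (\<forall>x\<in>S. \<forall>y\<in>S. x - y \<in> S)"

definition additive_on :: "'m::ab_group_add set \<Rightarrow> ('m \<Rightarrow> 'n::ab_group_add) \<Rightarrow> bool" where
  "additive_on S f \<longleftrightarrow> (\<forall>x\<in>S. \<forall>y\<in>S. f (x + y) = f x + f y)"


section \<open>Simplicial commutative rings and their chains\<close>

text \<open>
  \<open>face A n i : A\<^sub>n\<^sub>+\<^sub>1 \<rightarrow> A\<^sub>n\<close> for \<open>i \<le> n + 1\<close>, and \<open>degen A n i : A\<^sub>n \<rightarrow> A\<^sub>n\<^sub>+\<^sub>1\<close> for \<open>i \<le> n\<close>.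
\<close>

record 'a simplicial_ring =
  obj :: "nat \<Rightarrow> 'a ring"
  face :: "nat \<Rightarrow> nat \<Rightarrow> 'a \<Rightarrow> 'a"
  degen :: "nat \<Rightarrow> nat \<Rightarrow> 'a \<Rightarrow> 'a"

definition simplicial_cring :: "'a simplicial_ring \<Rightarrow> bool" where
  "simplicial_cring A \<longleftrightarrow>
     (\<forall>n. cring (obj A n)) \<and>
     (\<forall>n. \<forall>i\<le>Suc n. face A n i \<in> ring_hom (obj A (Suc n)) (obj A n)) \<and>
     (\<forall>n. \<forall>i\<le>n. degen A n i \<in> ring_hom (obj A n) (obj A (Suc n))) \<and>
     (\<forall>n i j. \<forall>x\<in>carrier (obj A (Suc (Suc n))). i < j \<and> j \<le> Suc (Suc n) \<longrightarrow>
        face A n i (face A (Suc n) j x) = face A n (j - 1) (face A (Suc n) i x)) \<and>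
     (\<forall>n i j. \<forall>x\<in>carrier (obj A (Suc n)). i < j \<and> j \<le> Suc n \<longrightarrow>
        face A (Suc n) i (degen A (Suc n) j x) = degen A n (j - 1) (face A n i x)) \<and>
     (\<forall>n i j. \<forall>x\<in>carrier (obj A n). j \<le> n \<and> (i = j \<or> i = Suc j) \<longrightarrow>
        face A n i (degen A n j x) = x) \<and>
     (\<forall>n i j. \<forall>x\<in>carrier (obj A (Suc n)). Suc j < i \<and> i \<le> Suc (Suc n) \<longrightarrow>
        face A (Suc n) i (degen A (Suc n) j x) = degen A n j (face A n (i - 1) x)) \<and>
     (\<forall>n i j. \<forall>x\<in>carrier (obj A n). i \<le> j \<and> j \<le> n \<longrightarrow>
        degen A (Suc n) i (degen A n j x) = degen A (Suc n) (Suc j) (degen A n i x))"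

text \<open>
  The commutative dg ring of (unnormalised) chains: \<open>A\<^sub>n\<close> in degree \<open>n\<close>, with the alternating sum
  of the faces and the shuffle product. Its quotient by degenerate chains is the usual
  normalised one and is quasi-isomorphic to it.
\<close>

fun chain_dif :: "'a simplicial_ring \<Rightarrow> nat \<Rightarrow> 'a \<Rightarrow> 'a" where
  "chain_dif A 0 a = \<zero>\<^bsub>obj A 0\<^esub>"
| "chain_dif A (Suc n) a =
     (\<Oplus>\<^bsub>obj A n\<^esub>i\<in>{..Suc n}. if even i then face A n i a else \<ominus>\<^bsub>obj A n\<^esub> face A n i a)"

fun degens :: "'a simplicial_ring \<Rightarrow> nat \<Rightarrow> nat list \<Rightarrow> 'a \<Rightarrow> 'a" where
  "degens A n [] a = a"
| "degens A n (j # js) a = degens A (Suc n) js (degen A n j a)"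

text \<open>
  A \<open>(p,q)\<close>-shuffle \<open>(\<mu>,\<nu>)\<close> is determined by \<open>S = {\<mu>\<^sub>1 < \<dots> < \<mu>\<^sub>p} \<subseteq> {0, \<dots>, p+q-1}\<close>; its sign is
  the parity of \<open>\<Sum>\<^sub>i (\<mu>\<^sub>i - (i - 1)) = \<Sum>S - p (p - 1) / 2\<close>, and its term is
  \<open>s\<^bsub>\<nu>\<^sub>q\<^esub> \<cdots> s\<^bsub>\<nu>\<^sub>1\<^esub> a \<cdot> s\<^bsub>\<mu>\<^sub>p\<^esub> \<cdots> s\<^bsub>\<mu>\<^sub>1\<^esub> b\<close>.
\<close>

definition shuffle_mult :: "'a simplicial_ring \<Rightarrow> nat \<Rightarrow> nat \<Rightarrow> 'a \<Rightarrow> 'a \<Rightarrow> 'a" where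
  "shuffle_mult A p q a b =
     (\<Oplus>\<^bsub>obj A (p + q)\<^esub>S\<in>{S. S \<subseteq> {..<p + q} \<and> card S = p}.
        let c = degens A p (sorted_list_of_set ({..<p + q} - S)) a
                \<otimes>\<^bsub>obj A (p + q)\<^esub> degens A q (sorted_list_of_set S) b
        in if even (\<Sum>S - p * (p - 1) div 2) then c else \<ominus>\<^bsub>obj A (p + q)\<^esub> c)"


section \<open>Differential graded modules\<close>

text \<open>
  \<open>car M m\<close> is \<open>M\<^sub>m\<close>, \<open>dif M m : M\<^sub>m \<rightarrow> M\<^sub>m\<^sub>-\<^sub>1\<close>, and \<open>smul M p m : A\<^sub>p \<times> M\<^sub>m \<rightarrow> M\<^sub>m\<^sub>+\<^sub>p\<close>.
\<close>

record ('a, 'm) dgmod =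
  car :: "int \<Rightarrow> 'm set"
  dif :: "int \<Rightarrow> 'm \<Rightarrow> 'm"
  smul :: "nat \<Rightarrow> int \<Rightarrow> 'a \<Rightarrow> 'm \<Rightarrow> 'm"

definition dg_module :: "'a simplicial_ring \<Rightarrow> ('a, 'm::ab_group_add) dgmod \<Rightarrow> bool" where
  "dg_module A M \<longleftrightarrow>
     (\<forall>m. add_subgroup (car M m)) \<and>
     (\<forall>m. \<forall>x\<in>car M m. dif M m x \<in> car M (m - 1)) \<and>
     (\<forall>m. additive_on (car M m) (dif M m)) \<and>
     (\<forall>m. \<forall>x\<in>car M m. dif M (m - 1) (dif M m x) = 0) \<and>
     (\<forall>p m. \<forall>a\<in>carrier (obj A p). \<forall>x\<in>car M m. smul M p m a x \<in> car M (m + int p)) \<and>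
     (\<forall>p m. \<forall>a\<in>carrier (obj A p). additive_on (car M m) (smul M p m a)) \<and>
     (\<forall>p m. \<forall>a\<in>carrier (obj A p). \<forall>b\<in>carrier (obj A p). \<forall>x\<in>car M m.
        smul M p m (a \<oplus>\<^bsub>obj A p\<^esub> b) x = smul M p m a x + smul M p m b x) \<and>
     (\<forall>m. \<forall>x\<in>car M m. smul M 0 m \<one>\<^bsub>obj A 0\<^esub> x = x) \<and>
     (\<forall>p q m. \<forall>a\<in>carrier (obj A p). \<forall>b\<in>carrier (obj A q). \<forall>x\<in>car M m.
        smul M (p + q) m (shuffle_mult A p q a b) x
          = smul M p (m + int q) a (smul M q m b x)) \<and>
     (\<forall>p m. \<forall>a\<in>carrier (obj A p). \<forall>x\<in>car M m.
        dif M (m + int p) (smul M p m a x)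
          = (if p = 0 then 0 else smul M (p - 1) m (chain_dif A p a) x)
            + ksign (int p) (smul M p (m - 1) a (dif M m x)))"

definition dg_map :: "'a simplicial_ring \<Rightarrow> ('a, 'm::ab_group_add) dgmod \<Rightarrow>
    ('a, 'n::ab_group_add) dgmod \<Rightarrow> (int \<Rightarrow> 'm \<Rightarrow> 'n) \<Rightarrow> bool" where
  "dg_map A M N f \<longleftrightarrow>
     (\<forall>m. \<forall>x\<in>car M m. f m x \<in> car N m) \<and>
     (\<forall>m. additive_on (car M m) (f m)) \<and>
     (\<forall>m. \<forall>x\<in>car M m. f (m - 1) (dif M m x) = dif N m (f m x)) \<and>
     (\<forall>p m. \<forall>a\<in>carrier (obj A p). \<forall>x\<in>car M m.
        f (m + int p) (smul M p m a x) = smul N p m a (f m x))"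

text \<open>The two conditions say that the map is injective, respectively surjective, on homology.\<close>

definition quasi_iso :: "'a simplicial_ring \<Rightarrow> ('a, 'm::ab_group_add) dgmod \<Rightarrow>
    ('a, 'n::ab_group_add) dgmod \<Rightarrow> (int \<Rightarrow> 'm \<Rightarrow> 'n) \<Rightarrow> bool" where
  "quasi_iso A M N f \<longleftrightarrow> dg_map A M N f \<and>
     (\<forall>m. \<forall>x\<in>car M m. dif M m x = 0 \<and> (\<exists>y\<in>car N (m + 1). f m x = dif N (m + 1) y) \<longrightarrow>
        (\<exists>z\<in>car M (m + 1). x = dif M (m + 1) z)) \<and>
     (\<forall>m. \<forall>y\<in>car N m. dif N m y = 0 \<longrightarrow>
        (\<exists>x\<in>car M m. \<exists>w\<in>car N (m + 1). dif M m x = 0 \<and> y = f m x + dif N (m + 1) w))"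

text \<open>
  Every isomorphism in the derived category is a span of quasi-isomorphisms. A definition cannot
  quantify over the type carrying the apex, so that type is an argument.
\<close>

definition dg_equiv :: "'p::ab_group_add itself \<Rightarrow> 'a simplicial_ring \<Rightarrow>
    ('a, 'm::ab_group_add) dgmod \<Rightarrow> ('a, 'n::ab_group_add) dgmod \<Rightarrow> bool" where
  "dg_equiv _ A M N \<longleftrightarrow> (\<exists>(P :: ('a, 'p) dgmod) f g.
     dg_module A P \<and> quasi_iso A P M f \<and> quasi_iso A P N g)"

definition acyclic :: "('a, 'm::ab_group_add) dgmod \<Rightarrow> bool" where
  "acyclic M \<longleftrightarrow> (\<forall>m. \<forall>x\<in>car M m. dif M m x = 0 \<longrightarrow> (\<exists>y\<in>car M (m + 1). x = dif M (m + 1) y))"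

text \<open>The shift \<open>M[k]\<close>.\<close>

definition dg_shift :: "int \<Rightarrow> ('a, 'm::ab_group_add) dgmod \<Rightarrow> ('a, 'm) dgmod" where
  "dg_shift k M =
     \<lparr>car = (\<lambda>m. car M (m - k)),
      dif = (\<lambda>m x. ksign k (dif M (m - k) x)),
      smul = (\<lambda>p m a x. ksign (k * int p) (smul M p (m - k) a x))\<rparr>"

text \<open>The cofibre of \<open>f : M \<rightarrow> N\<close> as the mapping cone \<open>M[1] \<oplus> N\<close>.\<close>

definition dg_cofib :: "('a, 'm::ab_group_add) dgmod \<Rightarrow> ('a, 'n::ab_group_add) dgmod \<Rightarrow>
    (int \<Rightarrow> 'm \<Rightarrow> 'n) \<Rightarrow> ('a, 'm \<times> 'n) dgmod" where
  "dg_cofib M N f =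
     \<lparr>car = (\<lambda>m. car M (m - 1) \<times> car N m),
      dif = (\<lambda>m (x, y). (- dif M (m - 1) x, dif N m y + f (m - 1) x)),
      smul = (\<lambda>p m a (x, y). (ksign (int p) (smul M p (m - 1) a x), smul N p m a y))\<rparr>"

definition dg_prod :: "(int \<Rightarrow> ('a, 'm::ab_group_add) dgmod) \<Rightarrow> ('a, int \<Rightarrow> 'm) dgmod" where
  "dg_prod M =
     \<lparr>car = (\<lambda>m. {x. \<forall>n. x n \<in> car (M n) m}),
      dif = (\<lambda>m x n. dif (M n) m (x n)),
      smul = (\<lambda>p m a x n. smul (M n) p m a (x n))\<rparr>"

definition dg_sum :: "(int \<Rightarrow> ('a, 'm::ab_group_add) dgmod) \<Rightarrow> ('a, int \<Rightarrow> 'm) dgmod" where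
  "dg_sum M =
     \<lparr>car = (\<lambda>m. {x. (\<forall>n. x n \<in> car (M n) m) \<and> finite {n. x n \<noteq> 0}}),
      dif = (\<lambda>m x n. dif (M n) m (x n)),
      smul = (\<lambda>p m a x n. smul (M n) p m a (x n))\<rparr>"


section \<open>Filtered and graded objects\<close>

text \<open>\<open>lev F n\<close> is \<open>F\<^sup>n\<close> and \<open>trn F n : F\<^sup>n\<^sup>+\<^sup>1 \<rightarrow> F\<^sup>n\<close>.\<close>

record ('a, 'm) fildg =
  lev :: "int \<Rightarrow> ('a, 'm) dgmod"
  trn :: "int \<Rightarrow> int \<Rightarrow> 'm \<Rightarrow> 'm"

definition filtered_module ::
    "'a simplicial_ring \<Rightarrow> ('a, 'm::ab_group_add, 'z) fildg_scheme \<Rightarrow> bool" where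
  "filtered_module A F \<longleftrightarrow>
     (\<forall>n. dg_module A (lev F n)) \<and> (\<forall>n. dg_map A (lev F (n + 1)) (lev F n) (trn F n))"

definition fil_gr :: "('a, 'm::ab_group_add, 'z) fildg_scheme \<Rightarrow> int \<Rightarrow> ('a, 'm \<times> 'm) dgmod" where
  "fil_gr F n = dg_cofib (lev F (n + 1)) (lev F n) (trn F n)"

definition one_minus_trn ::
    "('a, 'm::ab_group_add, 'z) fildg_scheme \<Rightarrow> int \<Rightarrow> (int \<Rightarrow> 'm) \<Rightarrow> int \<Rightarrow> 'm" where
  "one_minus_trn F m x = (\<lambda>n. x n - trn F n m (x (n + 1)))"

text \<open>
  \<open>lim\<^bsub>n\<rightarrow>\<infinity>\<^esub> F\<^sup>n\<close> is the fibre of \<open>1 - trn\<close> on \<open>\<Prod>\<^sub>n F\<^sup>n\<close>, and \<open>colim F = colim\<^bsub>n\<rightarrow>-\<infinity>\<^esub> F\<^sup>n\<close> is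
  the cofibre of \<open>1 - trn\<close> on \<open>\<Oplus>\<^sub>n F\<^sup>n\<close> (mapping telescope).
\<close>

definition fil_lim ::
    "('a, 'm::ab_group_add, 'z) fildg_scheme \<Rightarrow> ('a, (int \<Rightarrow> 'm) \<times> (int \<Rightarrow> 'm)) dgmod" where
  "fil_lim F = dg_shift (- 1) (dg_cofib (dg_prod (lev F)) (dg_prod (lev F)) (one_minus_trn F))"

definition fil_colim ::
    "('a, 'm::ab_group_add, 'z) fildg_scheme \<Rightarrow> ('a, (int \<Rightarrow> 'm) \<times> (int \<Rightarrow> 'm)) dgmod" where
  "fil_colim F = dg_cofib (dg_sum (lev F)) (dg_sum (lev F)) (one_minus_trn F)"

definition complete_filtered ::
    "'a simplicial_ring \<Rightarrow> ('a, 'm::ab_group_add, 'z) fildg_scheme \<Rightarrow> bool" where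
  "complete_filtered A F \<longleftrightarrow> filtered_module A F \<and> acyclic (fil_lim F)"

text \<open>
  An object of \<open>DG\<^sub>\<plusminus>\<close>: a graded dg module with the action of \<open>\<D>\<^sub>\<plusminus> = \<int> \<oplus> \<int>\<epsilon>\<close>, where \<open>\<epsilon>\<close> has
  weight \<open>1\<close>, degree \<open>c = \<plusminus>1\<close> and square \<open>0\<close>; \<open>eps Y n m\<close> is the action of \<open>\<epsilon>\<close> on \<open>Y\<^sup>n\<^sub>m\<close>.
\<close>

record ('a, 'm) grdg =
  wgt :: "int \<Rightarrow> ('a, 'm) dgmod"
  eps :: "int \<Rightarrow> int \<Rightarrow> 'm \<Rightarrow> 'm"

definition dg_object ::
    "int \<Rightarrow> 'a simplicial_ring \<Rightarrow> ('a, 'm::ab_group_add) grdg \<Rightarrow> bool" where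
  "dg_object c A Y \<longleftrightarrow>
     (\<forall>n. dg_module A (wgt Y n)) \<and>
     (\<forall>n m. \<forall>x\<in>car (wgt Y n) m. eps Y n m x \<in> car (wgt Y (n + 1)) (m + c)) \<and>
     (\<forall>n m. additive_on (car (wgt Y n) m) (eps Y n m)) \<and>
     (\<forall>n m. \<forall>x\<in>car (wgt Y n) m. eps Y (n + 1) (m + c) (eps Y n m x) = 0) \<and>
     (\<forall>n m. \<forall>x\<in>car (wgt Y n) m.
        dif (wgt Y (n + 1)) (m + c) (eps Y n m x) = - eps Y n (m - 1) (dif (wgt Y n) m x)) \<and>
     (\<forall>n p m. \<forall>a\<in>carrier (obj A p). \<forall>x\<in>car (wgt Y n) m.
        eps Y n (m + int p) (smul (wgt Y n) p m a x)
          = ksign (int p) (smul (wgt Y (n + 1)) p (m + c) a (eps Y n m x)))"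

abbreviation "DG_plus \<equiv> dg_object 1"
abbreviation "DG_minus \<equiv> dg_object (- 1)"

text \<open>Equivalence in \<open>DG\<^sub>-\<close>, again as a span.\<close>

definition DG_minus_quasi_iso :: "'a simplicial_ring \<Rightarrow> ('a, 'm::ab_group_add) grdg \<Rightarrow>
    ('a, 'n::ab_group_add) grdg \<Rightarrow> (int \<Rightarrow> int \<Rightarrow> 'm \<Rightarrow> 'n) \<Rightarrow> bool" where
  "DG_minus_quasi_iso A Y Z f \<longleftrightarrow>
     (\<forall>n. quasi_iso A (wgt Y n) (wgt Z n) (f n)) \<and>
     (\<forall>n m. \<forall>x\<in>car (wgt Y n) m. f (n + 1) (m - 1) (eps Y n m x) = eps Z n m (f n m x))"

definition DG_minus_equiv :: "'p::ab_group_add itself \<Rightarrow> 'a simplicial_ring \<Rightarrow>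
    ('a, 'm::ab_group_add) grdg \<Rightarrow> ('a, 'n::ab_group_add) grdg \<Rightarrow> bool" where
  "DG_minus_equiv _ A Y Z \<longleftrightarrow> (\<exists>(P :: ('a, 'p) grdg) f g.
     DG_minus A P \<and> DG_minus_quasi_iso A P Y f \<and> DG_minus_quasi_iso A P Z g)"


section \<open>The filtered circle and its modules\<close>

text \<open>
  \<open>\<T> = \<int>[S\<^sup>1]\<close> is presented by the cellular chains of the topological group \<open>S\<^sup>1\<close> with one \<open>0\<close>-cell
  and one \<open>1\<close>-cell: the pair \<open>(a, b)\<close> stands for \<open>a + b\<epsilon>\<close>, with \<open>\<epsilon>\<close> in degree \<open>1\<close> and \<open>\<epsilon>\<^sup>2 = 0\<close>.
\<close>

definition circle_car :: "int \<Rightarrow> (int \<times> int) set" where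
  "circle_car k = (if k = 0 then UNIV \<times> {0} else if k = 1 then {0} \<times> UNIV else {0})"

definition circle_dif :: "int \<Rightarrow> int \<times> int \<Rightarrow> int \<times> int" where
  "circle_dif k t = 0"

definition circle_mult :: "int \<times> int \<Rightarrow> int \<times> int \<Rightarrow> int \<times> int" where
  "circle_mult s t = (fst s * fst t, fst s * snd t + snd s * fst t)"

definition postnikov ::
    "(int \<Rightarrow> 't::ab_group_add set) \<Rightarrow> (int \<Rightarrow> 't \<Rightarrow> 't) \<Rightarrow> int \<Rightarrow> int \<Rightarrow> 't set" where
  "postnikov C d j k = (if k < j then {0} else if k = j then {x \<in> C k. d k x = 0} else C k)"

definition T_fil :: "int \<Rightarrow> int \<Rightarrow> (int \<times> int) set" where
  "T_fil = postnikov circle_car circle_dif"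

text \<open>
  A module over \<open>\<T>\<^sub>f\<^sub>i\<^sub>l\<close> for Day convolution is a natural family of pairings
  \<open>tact X j k t n m : X\<^sup>n\<^sub>m \<rightarrow> X\<^sup>n\<^sup>+\<^sup>j\<^sub>m\<^sub>+\<^sub>k\<close> for \<open>t \<in> (\<T>\<^sub>f\<^sub>i\<^sub>l)\<^sup>j\<^sub>k\<close>.
\<close>

record ('a, 'm) circle_fildg = "('a, 'm) fildg" +
  tact :: "int \<Rightarrow> int \<Rightarrow> int \<times> int \<Rightarrow> int \<Rightarrow> int \<Rightarrow> 'm \<Rightarrow> 'm"

definition filtered_circle_module ::
    "'a simplicial_ring \<Rightarrow> ('a, 'm::ab_group_add) circle_fildg \<Rightarrow> bool" where
  "filtered_circle_module A X \<longleftrightarrow> filtered_module A X \<and>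
     (\<forall>j k n m. \<forall>t\<in>T_fil j k. \<forall>x\<in>car (lev X n) m.
        tact X j k t n m x \<in> car (lev X (n + j)) (m + k)) \<and>
     (\<forall>j k n m. \<forall>t\<in>T_fil j k. additive_on (car (lev X n) m) (tact X j k t n m)) \<and>
     (\<forall>j k n m. \<forall>x\<in>car (lev X n) m. additive_on (T_fil j k) (\<lambda>t. tact X j k t n m x)) \<and>
     (\<forall>n m. \<forall>x\<in>car (lev X n) m. tact X 0 0 (1, 0) n m x = x) \<and>
     (\<forall>i h j k n m. \<forall>s\<in>T_fil i h. \<forall>t\<in>T_fil j k. \<forall>x\<in>car (lev X n) m.
        tact X (i + j) (h + k) (circle_mult s t) n m x
          = tact X i h s (n + j) (m + k) (tact X j k t n m x)) \<and>
     (\<forall>j k n m. \<forall>t\<in>T_fil j k. \<forall>x\<in>car (lev X n) m.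
        dif (lev X (n + j)) (m + k) (tact X j k t n m x)
          = tact X j (k - 1) (circle_dif k t) n m x
            + ksign k (tact X j k t n (m - 1) (dif (lev X n) m x))) \<and>
     (\<forall>j k n p m. \<forall>t\<in>T_fil j k. \<forall>a\<in>carrier (obj A p). \<forall>x\<in>car (lev X n) m.
        tact X j k t n (m + int p) (smul (lev X n) p m a x)
          = ksign (k * int p) (smul (lev X (n + j)) p (m + k) a (tact X j k t n m x))) \<and>
     (\<forall>j k n m. \<forall>t\<in>T_fil (j + 1) k. \<forall>x\<in>car (lev X n) m.
        trn X (n + j) (m + k) (tact X (j + 1) k t n m x) = tact X j k t n m x) \<and>
     (\<forall>j k n m. \<forall>t\<in>T_fil j k. \<forall>x\<in>car (lev X (n + 1)) m.
        trn X (n + j) (m + k) (tact X j k t (n + 1) m x) = tact X j k t n m (trn X n m x))"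

text \<open>The action of the generator \<open>\<epsilon> \<in> (\<T>\<^sub>f\<^sub>i\<^sub>l)\<^sup>1\<^sub>1\<close>.\<close>

definition circle_eps :: "('a, 'm) circle_fildg \<Rightarrow> int \<Rightarrow> int \<Rightarrow> 'm \<Rightarrow> 'm" where
  "circle_eps X = tact X 1 1 (0, 1)"

text \<open>
  \<open>gr(X)\<close> as an object of \<open>DG\<^sub>+\<close>, where \<open>\<D>\<^sub>+ \<simeq> gr(\<T>\<^sub>f\<^sub>i\<^sub>l)\<close> takes \<open>\<epsilon>\<close> to the class of \<open>\<epsilon>\<close>. The sign is the
  Koszul sign on the summand \<open>X\<^sup>n\<^sup>+\<^sup>1[1]\<close> of the cone.
\<close>

definition gr_plus :: "('a, 'm::ab_group_add) circle_fildg \<Rightarrow> ('a, 'm \<times> 'm) grdg" where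
  "gr_plus X =
     \<lparr>wgt = fil_gr X,
      eps = (\<lambda>n m (x, y). (- circle_eps X (n + 1) (m - 1) x, circle_eps X n m y))\<rparr>"


section \<open>Fixed points and the Tate construction\<close>

text \<open>
  \<open>X\<^sub>H = \<one> \<otimes>\<^sub>H X\<close> for \<open>H = \<T>\<^sub>f\<^sub>i\<^sub>l\<close>, computed by the normalised bar construction \<open>B(\<one>, H, X)\<close>. The
  augmentation ideal of \<open>\<T>\<^sub>f\<^sub>i\<^sub>l\<close> is \<open>\<one>[1](1)\<close>, generated by \<open>\<epsilon>\<close>, so the bars of length \<open>k\<close> form
  \<open>X[2k](k)\<close>: the sequence \<open>x\<close> stands for the finite sum \<open>\<Sum>\<^sub>k [\<epsilon>|\<dots>|\<epsilon>] x\<^sub>k\<close>. As \<open>\<epsilon>\<^sup>2 = 0\<close> and \<open>\<epsilon>\<close> acts by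
  \<open>0\<close> on \<open>\<one>\<close>, the only bar face that survives is the one which lets the last \<open>\<epsilon>\<close> act on \<open>x\<^sub>k\<close>.
\<close>

definition orbits :: "('a, 'm::ab_group_add) circle_fildg \<Rightarrow> ('a, nat \<Rightarrow> 'm) fildg" where
  "orbits X =
     \<lparr>lev = (\<lambda>n.
        \<lparr>car = (\<lambda>m. {x. (\<forall>k. x k \<in> car (lev X (n - int k)) (m - 2 * int k))
                        \<and> finite {k. x k \<noteq> 0}}),
         dif = (\<lambda>m x k. dif (lev X (n - int k)) (m - 2 * int k) (x k)
                 + circle_eps X (n - int (Suc k)) (m - 2 * int (Suc k)) (x (Suc k))),
         smul = (\<lambda>p m a x k. smul (lev X (n - int k)) p (m - 2 * int k) a (x k))\<rparr>),
      trn = (\<lambda>n m x k. trn X (n - int k) (m - 2 * int k) (x k))\<rparr>"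

text \<open>
  \<open>X\<^sup>H = Map\<^sub>H(\<one>, X)\<close>, computed by the normalised cobar construction, that is, by the \<open>H\<close>-linear
  maps \<open>B(H, H, \<one>) \<rightarrow> X\<close>. The resolution \<open>B(H, H, \<one>)\<close> is free over \<open>H\<close> on generators \<open>[\<epsilon>|\<dots>|\<epsilon>]\<close>
  (\<open>k\<close> bars) of degree \<open>2k\<close> and filtration \<open>k\<close>, with \<open>d [\<epsilon>|\<dots>|\<epsilon>] = \<plusminus>\<epsilon> [\<epsilon>|\<dots>|\<epsilon>]\<close> (\<open>k - 1\<close> bars on the
  right); the sequence \<open>f\<close> lists the values of a map on the generators.
\<close>

definition fixed_points :: "('a, 'm::ab_group_add) circle_fildg \<Rightarrow> ('a, nat \<Rightarrow> 'm) fildg" where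
  "fixed_points X =
     \<lparr>lev = (\<lambda>n.
        \<lparr>car = (\<lambda>m. {f. \<forall>k. f k \<in> car (lev X (n + int k)) (m + 2 * int k)}),
         dif = (\<lambda>m f k. dif (lev X (n + int k)) (m + 2 * int k) (f k)
                 + (if k = 0 then 0
                    else circle_eps X (n + int (k - 1)) (m + 2 * int (k - 1)) (f (k - 1)))),
         smul = (\<lambda>p m a f k. smul (lev X (n + int k)) p (m + 2 * int k) a (f k))\<rparr>),
      trn = (\<lambda>n m f k. trn X (n + int k) (m + 2 * int k) (f k))\<rparr>"

text \<open>\<open>\<omega> \<otimes> F\<close> for \<open>\<omega> = \<one>[1](1)\<close>.\<close>

definition omega_tensor :: "('a, 'm::ab_group_add) fildg \<Rightarrow> ('a, 'm) fildg" where
  "omega_tensor F =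
     \<lparr>lev = (\<lambda>n. dg_shift 1 (lev F (n - 1))),
      trn = (\<lambda>n m x. trn F (n - 1) (m - 1) x)\<rparr>"

text \<open>
  The norm \<open>\<omega> \<otimes> X\<^sub>H \<rightarrow> X\<^sup>H\<close>. The equivalence \<open>\<alpha> : H\<^sup>\<or> \<simeq> \<omega>\<^sup>-\<^sup>1 \<otimes> H\<close> identifies \<open>t \<in> H\<close> with the
  functional taking \<open>s\<close> to the \<open>\<epsilon>\<close>-coefficient of \<open>s t\<close>, hence \<open>\<eta>(1) \<in> H\<^sup>\<or>\<close>, which is the counit, with
  \<open>\<epsilon>\<close>. So \<open>\<omega> \<otimes> B(\<one>, H, X) \<rightarrow> \<omega> \<otimes> B(H\<^sup>\<or>, H, X) \<simeq> X\<close> takes \<open>\<Sum>\<^sub>k [\<epsilon>|\<dots>|\<epsilon>] x\<^sub>k\<close> to \<open>\<epsilon> x\<^sub>0\<close>. Its values are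
  annihilated by \<open>\<epsilon>\<close>, and its factorisation through \<open>X\<^sup>H \<rightarrow> X\<close>, \<open>f \<mapsto> f\<^sub>0\<close>, takes \<open>x\<close> to the composite
  of \<open>B(H, H, \<one>) \<rightarrow> \<one>\<close> with \<open>1 \<mapsto> \<epsilon> x\<^sub>0\<close>, which vanishes on the generators with \<open>k > 0\<close>.
\<close>

definition norm_map ::
    "('a, 'm::ab_group_add) circle_fildg \<Rightarrow> int \<Rightarrow> int \<Rightarrow> (nat \<Rightarrow> 'm) \<Rightarrow> nat \<Rightarrow> 'm" where
  "norm_map X n m x = (\<lambda>k. if k = 0 then circle_eps X (n - 1) (m - 1) (x 0) else 0)"

definition tate ::
    "('a, 'm::ab_group_add) circle_fildg \<Rightarrow> ('a, (nat \<Rightarrow> 'm) \<times> (nat \<Rightarrow> 'm)) fildg" where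
  "tate X =
     \<lparr>lev = (\<lambda>n. dg_cofib (lev (omega_tensor (orbits X)) n) (lev (fixed_points X) n) (norm_map X n)),
      trn = (\<lambda>n m (x, f). (trn (omega_tensor (orbits X)) n (m - 1) x, trn (fixed_points X) n m f))\<rparr>"


section \<open>Brutal filtration and cohomology type\<close>

text \<open>
  The refinement of \<open>gr\<close> to a functor from filtered objects to \<open>DG\<^sub>-\<close>. The cone
  \<open>gr\<^sup>n(F) = F\<^sup>n\<^sup>+\<^sup>1[1] \<oplus> F\<^sup>n\<close> computes the weight \<open>n\<close> part of \<open>\<one> \<otimes>\<^bsub>\<one>[t]\<^esub> F\<close> by the Koszul resolution of
  \<open>\<one>\<close> over \<open>\<one>[t]\<close>, and the coaction of \<open>Bar(\<one>[t]) \<simeq> \<D>\<^sub>-\<^sup>\<or>\<close> becomes the action of \<open>\<epsilon>\<close> by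
  \<open>gr\<^sup>n(F) \<rightarrow> F\<^sup>n\<^sup>+\<^sup>1[1] \<rightarrow> gr\<^sup>n\<^sup>+\<^sup>1(F)[1]\<close>.
\<close>

definition gr_bar :: "('a, 'm::ab_group_add) fildg \<Rightarrow> ('a, 'm \<times> 'm) grdg" where
  "gr_bar F = \<lparr>wgt = fil_gr F, eps = (\<lambda>n m (x, y). (0, x))\<rparr>"

text \<open>The shear \<open>Y[-2*]\<close>, which carries \<open>DG\<^sub>+\<close> to \<open>DG\<^sub>-\<close>.\<close>

definition shear :: "('a, 'm::ab_group_add) grdg \<Rightarrow> ('a, 'm) grdg" where
  "shear Y = \<lparr>wgt = (\<lambda>n. dg_shift (- 2 * n) (wgt Y n)), eps = (\<lambda>n m. eps Y n (m + 2 * n))\<rparr>"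

text \<open>
  \<open>F\<close> presents \<open>|Y|\<^sup>\<ge>\<^sup>\<star>\<close>, the inverse image of \<open>Y[-2*]\<close> under the equivalence \<open>gr_bar\<close> between complete
  filtered objects and \<open>DG\<^sub>-\<close>; the type \<open>'p\<close> carries the apex of the span. The cohomology type
  \<open>|Y|\<close> is then \<open>fil_colim F\<close>.
\<close>

definition is_brutal_filtration :: "'p::ab_group_add itself \<Rightarrow> 'a simplicial_ring \<Rightarrow>
    ('a, 'm::ab_group_add) grdg \<Rightarrow> ('a, 'n::ab_group_add) fildg \<Rightarrow> bool" where
  "is_brutal_filtration T A Y F \<longleftrightarrow>
     complete_filtered A F \<and> DG_minus_equiv T A (gr_bar F) (shear Y)"

end

theory Submission
  imports Defs
begin

text \<open>
  For \<open>Z\<close> in \<open>DG\<^sub>-\<close>, the bounded-below families \<open>z\<^sub>n \<in> Z\<^sup>n\<close> with the differential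
  \<open>z \<mapsto> (d z\<^sub>n - \<epsilon> z\<^sub>n\<^sub>-\<^sub>1)\<^sub>n\<close> form a filtered complex whose step \<open>i\<close> consists of the families that vanish
  below \<open>i\<close>. It depends on \<open>Z\<close> only up to quasi-isomorphism, since a primitive of a bounded-below
  cycle can be found weight by weight. For the sheared \<open>gr(X)\<close> its steps are, up to signs and the shift
  by \<open>2i\<close>, literally \<open>gr\<^sup>i\<close> of the cobar construction, and the whole complex is \<open>gr\<^sup>i\<close> of the Tate
  construction. For the refined \<open>gr\<close> of a complete filtered object \<open>F\<close> the step \<open>i\<close> is a model of
  \<open>F\<^sup>i\<close>, because the cofibre of the inclusion of \<open>F\<^sup>i\<close> is a limit over the levels above \<open>i\<close>, and the
  whole complex is a model of \<open>colim F\<close>. The resulting cospans of quasi-isomorphisms become spans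
  by homotopy pullback.
\<close>

text \<open>Orbits are finite sums of bar coordinates, fixed points are arbitrary products of cobar
  coordinates, and the norm is the action of \<open>\<epsilon>\<close> from bar coordinate 0 to
  cobar coordinate 0. Glued along the norm they become one family indexed by all integers, finite
  downwards and unrestricted upwards. This is why bounded-below families are the right completion,
  and why restricting to indices from \<open>i\<close> on gives the fixed points. The shift by
  \<open>2 * i\<close> comes from the degrees: cobar coordinate \<open>k\<close> of step
  \<open>i\<close> has filtration \<open>n = i + k\<close> and degree raised by
  \<open>2 * k = 2 * n - 2 * i\<close>, where \<open>2 * n\<close> is due to the shear. The inverse
  of \<open>gr_bar\<close> is not given by a formula: a brutal filtration is any complete
  \<open>F\<close> whose \<open>gr_bar\<close> is joined to the shear by a span. Hence every
  comparison passes through the twisted product of \<open>gr_bar F\<close>, and completeness is what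
  recovers \<open>F\<close> from it, by contracting all components above a given level.\<close>

lemma ksign_0 [simp]: "ksign k 0 = 0"
  by (simp add: ksign_def)

lemma ksign_eq_0_iff: "ksign k x = 0 \<longleftrightarrow> x = 0"
  by (simp add: ksign_def)

lemma ksign_ksign: "ksign j (ksign k x) = ksign (j + k) x"
  by (auto simp: ksign_def)

lemma ksign_even [simp]: "even k \<Longrightarrow> ksign k x = x"
  by (simp add: ksign_def)

section \<open>Subgroups and additive maps\<close>

lemma add_subgroup_0: "add_subgroup S \<Longrightarrow> 0 \<in> S"
  by (simp add: add_subgroup_def)

lemma add_subgroup_diff: "add_subgroup S \<Longrightarrow> x \<in> S \<Longrightarrow> y \<in> S \<Longrightarrow> x - y \<in> S"
  by (simp add: add_subgroup_def)

lemma add_subgroup_uminus: "add_subgroup S \<Longrightarrow> x \<in> S \<Longrightarrow> - x \<in> S"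
  using add_subgroup_diff[of S 0 x] by (simp add: add_subgroup_0)

lemma add_subgroup_add: "add_subgroup S \<Longrightarrow> x \<in> S \<Longrightarrow> y \<in> S \<Longrightarrow> x + y \<in> S"
  using add_subgroup_diff[of S x "- y"] by (simp add: add_subgroup_uminus)

lemma add_subgroup_ksign: "add_subgroup S \<Longrightarrow> x \<in> S \<Longrightarrow> ksign k x \<in> S"
  by (simp add: ksign_def add_subgroup_uminus)

lemmas add_subgroup_closed =
  add_subgroup_0 add_subgroup_diff add_subgroup_uminus add_subgroup_add add_subgroup_ksign

lemma additive_on_add: "additive_on S f \<Longrightarrow> x \<in> S \<Longrightarrow> y \<in> S \<Longrightarrow> f (x + y) = f x + f y"
  by (simp add: additive_on_def)

lemma additive_on_0:
  assumes "add_subgroup S" "additive_on S f"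
  shows "f 0 = 0"
  using additive_on_add[OF assms(2), of 0 0] assms(1) by (simp add: add_subgroup_0)

lemma additive_on_uminus:
  assumes "add_subgroup S" "additive_on S f" "x \<in> S"
  shows "f (- x) = - f x"
  using additive_on_add[OF assms(2), of x "- x"] assms
  by (simp add: add_subgroup_uminus additive_on_0 minus_unique)

lemma additive_on_diff:
  assumes "add_subgroup S" "additive_on S f" "x \<in> S" "y \<in> S"
  shows "f (x - y) = f x - f y"
  using additive_on_add[OF assms(2), of x "- y"] assms
  by (simp add: add_subgroup_uminus additive_on_uminus)

lemma additive_on_ksign:
  assumes "add_subgroup S" "additive_on S f" "x \<in> S"
  shows "f (ksign k x) = ksign k (f x)"
  using assms by (simp add: ksign_def additive_on_uminus)

lemmas additive_on_simps =
  additive_on_0 additive_on_uminus additive_on_diff additive_on_ksign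


section \<open>Differential graded modules and quasi-isomorphisms\<close>

lemma dg_moduleI:
  assumes "\<And>m. add_subgroup (car M m)"
    and "\<And>m x. x \<in> car M m \<Longrightarrow> dif M m x \<in> car M (m - 1)"
    and "\<And>m x y. x \<in> car M m \<Longrightarrow> y \<in> car M m \<Longrightarrow> dif M m (x + y) = dif M m x + dif M m y"
    and "\<And>m x. x \<in> car M m \<Longrightarrow> dif M (m - 1) (dif M m x) = 0"
    and "\<And>p m a x. a \<in> carrier (obj A p) \<Longrightarrow> x \<in> car M m \<Longrightarrow> smul M p m a x \<in> car M (m + int p)"
    and "\<And>p m a x y. a \<in> carrier (obj A p) \<Longrightarrow> x \<in> car M m \<Longrightarrow> y \<in> car M m \<Longrightarrow>
      smul M p m a (x + y) = smul M p m a x + smul M p m a y"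
    and "\<And>p m a b x. a \<in> carrier (obj A p) \<Longrightarrow> b \<in> carrier (obj A p) \<Longrightarrow> x \<in> car M m \<Longrightarrow>
      smul M p m (a \<oplus>\<^bsub>obj A p\<^esub> b) x = smul M p m a x + smul M p m b x"
    and "\<And>m x. x \<in> car M m \<Longrightarrow> smul M 0 m \<one>\<^bsub>obj A 0\<^esub> x = x"
    and "\<And>p q m a b x. a \<in> carrier (obj A p) \<Longrightarrow> b \<in> carrier (obj A q) \<Longrightarrow> x \<in> car M m \<Longrightarrow>
      smul M (p + q) m (shuffle_mult A p q a b) x = smul M p (m + int q) a (smul M q m b x)"
    and "\<And>p m a x. a \<in> carrier (obj A p) \<Longrightarrow> x \<in> car M m \<Longrightarrow>
      dif M (m + int p) (smul M p m a x)
        = (if p = 0 then 0 else smul M (p - 1) m (chain_dif A p a) x)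
          + ksign (int p) (smul M p (m - 1) a (dif M m x))"
  shows "dg_module A M"
  unfolding dg_module_def additive_on_def by (intro conjI allI ballI; rule assms; assumption)

context
  fixes A :: "'a simplicial_ring" and M :: "('a, 'm::ab_group_add) dgmod"
  assumes M: "dg_module A M"
begin

lemma dg_module_subgroup: "add_subgroup (car M m)"
  using M by (simp add: dg_module_def)

lemma dg_module_dif_additive: "additive_on (car M m) (dif M m)"
  using M by (simp add: dg_module_def)

lemma dg_module_smul_additive: "a \<in> carrier (obj A p) \<Longrightarrow> additive_on (car M m) (smul M p m a)"
  using M by (simp add: dg_module_def)

lemmas dg_module_closed = add_subgroup_closed[OF dg_module_subgroup]

lemmas dg_module_dif = additive_on_simps[OF dg_module_subgroup dg_module_dif_additive]
  additive_on_add[OF dg_module_dif_additive]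

lemmas dg_module_smul = additive_on_simps[OF dg_module_subgroup dg_module_smul_additive]
  additive_on_add[OF dg_module_smul_additive]

text \<open>The target degree is a variable \<open>m'\<close> with an equation as side condition, so
  that simp can match indices that agree only up to integer arithmetic. The same device is used for
  maps, for \<open>eps\<close> and for transition maps.\<close>

lemma dg_module_dif_car: "x \<in> car M m \<Longrightarrow> m' = m - 1 \<Longrightarrow> dif M m x \<in> car M m'"
  using M by (simp add: dg_module_def)

lemma dg_module_dif_dif: "x \<in> car M m \<Longrightarrow> m' = m - 1 \<Longrightarrow> dif M m' (dif M m x) = 0"
  using M by (simp add: dg_module_def)

lemma dg_module_smul_car:
  "a \<in> carrier (obj A p) \<Longrightarrow> x \<in> car M m \<Longrightarrow> m' = m + int p \<Longrightarrow> smul M p m a x \<in> car M m'"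
  using M by (simp add: dg_module_def)

lemma dg_module_smul_left_add:
  "a \<in> carrier (obj A p) \<Longrightarrow> b \<in> carrier (obj A p) \<Longrightarrow> x \<in> car M m \<Longrightarrow>
    smul M p m (a \<oplus>\<^bsub>obj A p\<^esub> b) x = smul M p m a x + smul M p m b x"
  using M by (simp add: dg_module_def)

lemma dg_module_smul_one: "x \<in> car M m \<Longrightarrow> smul M 0 m \<one>\<^bsub>obj A 0\<^esub> x = x"
  using M by (simp add: dg_module_def)

lemma dg_module_smul_shuffle:
  "a \<in> carrier (obj A p) \<Longrightarrow> b \<in> carrier (obj A q) \<Longrightarrow> x \<in> car M m \<Longrightarrow> m' = m + int q \<Longrightarrow>
    smul M (p + q) m (shuffle_mult A p q a b) x = smul M p m' a (smul M q m b x)"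
  using M by (simp add: dg_module_def)

lemma dg_module_leibniz:
  "a \<in> carrier (obj A p) \<Longrightarrow> x \<in> car M m \<Longrightarrow> m' = m + int p \<Longrightarrow>
    dif M m' (smul M p m a x)
      = (if p = 0 then 0 else smul M (p - 1) m (chain_dif A p a) x)
        + ksign (int p) (smul M p (m - 1) a (dif M m x))"
  using M unfolding dg_module_def by blast

lemmas dg_module_simps =
  dg_module_closed dg_module_dif dg_module_smul
  dg_module_dif_car dg_module_dif_dif dg_module_smul_car
  dg_module_smul_left_add dg_module_smul_one dg_module_leibniz

end

lemma dg_mapI:
  assumes "\<And>m x. x \<in> car M m \<Longrightarrow> f m x \<in> car N m"
    and "\<And>m x y. x \<in> car M m \<Longrightarrow> y \<in> car M m \<Longrightarrow> f m (x + y) = f m x + f m y"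
    and "\<And>m x. x \<in> car M m \<Longrightarrow> f (m - 1) (dif M m x) = dif N m (f m x)"
    and "\<And>p m a x. a \<in> carrier (obj A p) \<Longrightarrow> x \<in> car M m \<Longrightarrow>
      f (m + int p) (smul M p m a x) = smul N p m a (f m x)"
  shows "dg_map A M N f"
  unfolding dg_map_def additive_on_def using assms by blast

context
  fixes A :: "'a simplicial_ring" and M :: "('a, 'm::ab_group_add) dgmod"
    and N :: "('a, 'n::ab_group_add) dgmod" and f
  assumes M: "dg_module A M" and f: "dg_map A M N f"
begin

lemma dg_map_car: "x \<in> car M m \<Longrightarrow> f m x \<in> car N m"
  using f by (simp add: dg_map_def)

lemma dg_map_additive: "additive_on (car M m) (f m)"
  using f by (simp add: dg_map_def)

lemma dg_map_dif: "x \<in> car M m \<Longrightarrow> m' = m - 1 \<Longrightarrow> f m' (dif M m x) = dif N m (f m x)"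
  using f by (simp add: dg_map_def)

lemma dg_map_smul:
  "a \<in> carrier (obj A p) \<Longrightarrow> x \<in> car M m \<Longrightarrow> m' = m + int p \<Longrightarrow>
    f m' (smul M p m a x) = smul N p m a (f m x)"
  using f by (simp add: dg_map_def)

lemmas dg_map_simps =
  dg_map_car additive_on_simps[OF dg_module_subgroup[OF M] dg_map_additive]
  additive_on_add[OF dg_map_additive] dg_map_dif dg_map_smul

end

lemma dg_module_shift:
  assumes "dg_module A M"
  shows "dg_module A (dg_shift k M)"
proof (rule dg_moduleI, goal_cases)
  \<comment> \<open>Goal 9 of \<open>dg_moduleI\<close> is associativity with the shuffle product.
    Its rule is not part of \<open>dg_module_simps\<close> and is instantiated by hand; the signs
    combine by \<open>k * p + k * q = k * (p + q)\<close>.\<close>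
  case (9 p q m a b x)
  then show ?case
    using dg_module_smul_shuffle[OF assms, of a p b q x "m - k", OF _ _ _ refl]
    by (simp add: dg_shift_def dg_module_simps[OF assms] dg_module_smul_car[OF assms]
      ksign_ksign algebra_simps)
next
  case (10 p m a x)
  then show ?case
    by (auto simp add: dg_shift_def dg_module_simps[OF assms] ksign_def algebra_simps)
qed (auto simp: dg_shift_def add_subgroup_def dg_module_simps[OF assms] ksign_ksign
    algebra_simps ksign_def)

lemma dg_module_cofib:
  assumes M: "dg_module A M" and N: "dg_module A N" and f: "dg_map A M N f"
  shows "dg_module A (dg_cofib M N f)"
proof (rule dg_moduleI, goal_cases)
  case (9 p q m a b x)
  then show ?case
    using dg_module_smul_shuffle[OF M, of a p b q "fst x" "m - 1", OF _ _ _ refl]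
      dg_module_smul_shuffle[OF N, of a p b q "snd x" m, OF _ _ _ refl]
    by (auto simp: dg_cofib_def dg_module_simps[OF M] dg_module_smul_car[OF M]
      ksign_ksign algebra_simps)
next
  case (10 p m a x)
  then show ?case
    by (auto simp: dg_cofib_def dg_module_simps[OF M] dg_module_simps[OF N] dg_map_simps[OF M f]
      ksign_def algebra_simps)
qed (auto simp: dg_cofib_def add_subgroup_def dg_module_simps[OF M] dg_module_simps[OF N]
    dg_map_simps[OF M f] ksign_def algebra_simps zero_prod_def)

section \<open>Quasi-isomorphisms and mapping cones\<close>

lemma quasi_iso_dg_map: "quasi_iso A M N f \<Longrightarrow> dg_map A M N f"
  by (simp add: quasi_iso_def)

lemma quasi_iso_inj:
  "quasi_iso A M N f \<Longrightarrow> x \<in> car M m \<Longrightarrow> dif M m x = 0 \<Longrightarrow> y \<in> car N (m + 1) \<Longrightarrow>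
    f m x = dif N (m + 1) y \<Longrightarrow> \<exists>z\<in>car M (m + 1). x = dif M (m + 1) z"
  unfolding quasi_iso_def by blast

lemma quasi_iso_surj:
  "quasi_iso A M N f \<Longrightarrow> y \<in> car N m \<Longrightarrow> dif N m y = 0 \<Longrightarrow>
    \<exists>x\<in>car M m. \<exists>w\<in>car N (m + 1). dif M m x = 0 \<and> y = f m x + dif N (m + 1) w"
  unfolding quasi_iso_def by blast

text \<open>A cone cycle \<open>(x, y)\<close> is a cycle \<open>x\<close> together with a primitive
  \<open>- y\<close> of its image. The cone cycles \<open>(x, - y)\<close> and \<open>(0, y)\<close>
  give injectivity and surjectivity on homology.\<close>

lemma acyclic_cofib_imp_quasi_iso:
  assumes M: "dg_module A M" and N: "dg_module A N" and f: "dg_map A M N f"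
    and ac: "acyclic (dg_cofib M N f)"
  shows "quasi_iso A M N f"
proof -
  have ac': "\<exists>z\<in>car M m. \<exists>w\<in>car N (m + 1). x = - dif M m z \<and> y = dif N (m + 1) w + f m z"
    if "x \<in> car M (m - 1)" "y \<in> car N m" "dif M (m - 1) x = 0" "dif N m y + f (m - 1) x = 0"
    for x y m
  proof -
    have "(x, y) \<in> car (dg_cofib M N f) m" "dif (dg_cofib M N f) m (x, y) = 0"
      using that by (simp_all add: dg_cofib_def zero_prod_def)
    with ac obtain zw where "zw \<in> car (dg_cofib M N f) (m + 1)"
      "(x, y) = dif (dg_cofib M N f) (m + 1) zw"
      unfolding acyclic_def by blast
    then show ?thesis
      by (cases zw) (auto simp: dg_cofib_def)
  qed
  show ?thesis
    unfolding quasi_iso_def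
  proof (intro conjI allI ballI impI f; (elim conjE bexE)?)
    fix m x y
    assume x: "x \<in> car M m" "dif M m x = 0" and y: "y \<in> car N (m + 1)" "f m x = dif N (m + 1) y"
    have "\<exists>z\<in>car M (m + 1). \<exists>w\<in>car N (m + 1 + 1). x = - dif M (m + 1) z
        \<and> - y = dif N (m + 1 + 1) w + f (m + 1) z"
      using x y by (intro ac') (simp_all add: dg_module_simps[OF N])
    then obtain z where "z \<in> car M (m + 1)" "x = - dif M (m + 1) z"
      by blast
    then show "\<exists>z\<in>car M (m + 1). x = dif M (m + 1) z"
      by (intro bexI[of _ "- z"]) (simp_all add: dg_module_simps[OF M])
  next
    fix m y
    assume y: "y \<in> car N m" "dif N m y = 0"
    have "\<exists>z\<in>car M m. \<exists>w\<in>car N (m + 1). 0 = - dif M m z \<and> y = dif N (m + 1) w + f m z"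
      using y by (intro ac') (simp_all add: dg_module_simps[OF M] dg_map_simps[OF M f])
    then show "\<exists>x\<in>car M m. \<exists>w\<in>car N (m + 1). dif M m x = 0 \<and> y = f m x + dif N (m + 1) w"
      by (metis add.commute neg_0_equal_iff_equal)
  qed
qed

lemma quasi_iso_imp_acyclic_cofib:
  assumes M: "dg_module A M" and N: "dg_module A N" and q: "quasi_iso A M N f"
  shows "acyclic (dg_cofib M N f)"
  unfolding acyclic_def
proof (intro allI ballI impI)
  note f = quasi_iso_dg_map[OF q]
  fix m xy
  assume xy: "xy \<in> car (dg_cofib M N f) m" "dif (dg_cofib M N f) m xy = 0"
  obtain x y where [simp]: "xy = (x, y)" by (cases xy)
  have x: "x \<in> car M (m - 1)" "dif M (m - 1) x = 0"
    and y: "y \<in> car N m" "dif N m y + f (m - 1) x = 0"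
    using xy by (auto simp: dg_cofib_def zero_prod_def)
  have "f (m - 1) x = dif N m (- y)"
    using y by (simp add: dg_module_simps[OF N] eq_neg_iff_add_eq_0 add.commute)
  then obtain z where z: "z \<in> car M m" "x = dif M m z"
    using quasi_iso_inj[OF q x, of "- y"] y by (auto simp: dg_module_simps[OF N])
  \<comment> \<open>Since \<open>z\<close> is a primitive of \<open>x\<close>, adding
    \<open>f m z\<close> turns \<open>y\<close> into a cycle; surjectivity on homology then yields
    the primitive \<open>(u - z, w)\<close> of the cone cycle.\<close>
  have "y + f m z \<in> car N m" "dif N m (y + f m z) = 0"
    using y z dg_map_dif[OF M f, of z m "m - 1"] by (simp_all add: dg_module_simps[OF N] dg_map_car[OF M f])
  then obtain u w where u: "u \<in> car M m" "dif M m u = 0" "w \<in> car N (m + 1)"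
    "y + f m z = f m u + dif N (m + 1) w"
    using quasi_iso_surj[OF q] by blast
  have "y = dif N (m + 1) w + f m (u - z)"
    using u z by (simp add: dg_map_simps[OF M f] algebra_simps)
  then show "\<exists>y\<in>car (dg_cofib M N f) (m + 1). xy = dif (dg_cofib M N f) (m + 1) y"
    using u z by (intro bexI[of _ "(u - z, w)"]) (simp_all add: dg_cofib_def dg_module_simps[OF M])
qed

text \<open>Bijectivity of \<open>g\<close> carries cycles and primitives of \<open>L\<close> back
  to \<open>N\<close>. This moves one end of a span onto the graded pieces of the fixed points and
  of the Tate construction, which are reached by bijective dg maps.\<close>

lemma quasi_iso_compose_bij:
  assumes M: "dg_module A M" and N: "dg_module A N"
    and q: "quasi_iso A M N f" and g: "dg_map A N L g"
    and bij: "\<And>m. bij_betw (g m) (car N m) (car L m)"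
  shows "quasi_iso A M L (\<lambda>m x. g m (f m x))"
  unfolding quasi_iso_def
proof (intro conjI allI ballI impI; (elim conjE bexE)?)
  note f' = dg_map_simps[OF M quasi_iso_dg_map[OF q]] and g' = dg_map_simps[OF N g]
  have inj: "x = y" if "g m x = g m y" "x \<in> car N m" "y \<in> car N m" for m x y
    using bij[of m] that by (auto simp: bij_betw_def dest: inj_onD)
  have surj: "\<exists>x\<in>car N m. y = g m x" if "y \<in> car L m" for m y
    using bij[of m] that unfolding bij_betw_def by blast
  show "dg_map A M L (\<lambda>m x. g m (f m x))"
    by (intro dg_mapI) (simp_all add: f' g')
  fix m
  {
    fix x y
    assume x: "x \<in> car M m" "dif M m x = 0"
      and y: "y \<in> car L (m + 1)" "g m (f m x) = dif L (m + 1) y"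
    obtain z where z: "z \<in> car N (m + 1)" "y = g (m + 1) z"
      using surj y by blast
    have "f m x = dif N (m + 1) z"
      using x y z by (intro inj[of m]) (simp_all add: g' f' dg_module_simps[OF N])
    then show "\<exists>z\<in>car M (m + 1). x = dif M (m + 1) z"
      using quasi_iso_inj[OF q x] z by blast
  }
  {
    fix y
    assume y: "y \<in> car L m" "dif L m y = 0"
    obtain z where z: "z \<in> car N m" "y = g m z"
      using surj y by blast
    have "dif N m z = 0"
      using y z by (intro inj[of "m - 1"]) (simp_all add: g' dg_module_simps[OF N])
    then obtain x w where xw: "x \<in> car M m" "w \<in> car N (m + 1)" "dif M m x = 0"
      "z = f m x + dif N (m + 1) w"
      using quasi_iso_surj[OF q] z by blast
    have "y = g m (f m x) + dif L (m + 1) (g (m + 1) w)"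
      using xw z by (simp add: g' f' dg_module_simps[OF N])
    then show "\<exists>x\<in>car M m. \<exists>w\<in>car L (m + 1).
        dif M m x = 0 \<and> y = g m (f m x) + dif L (m + 1) w"
      using xw g' by blast
  }
qed

lemma quasi_iso_id:
  assumes M: "dg_module A M"
  shows "quasi_iso A M M (\<lambda>m x. x)"
  unfolding quasi_iso_def
proof (intro conjI allI ballI impI)
  show "dg_map A M M (\<lambda>m x. x)"
    by (intro dg_mapI) simp_all
  show "\<exists>x\<in>car M m. \<exists>w\<in>car M (m + 1). dif M m x = 0 \<and> y = x + dif M (m + 1) w"
    if "y \<in> car M m" "dif M m y = 0" for m y
    using that by (intro bexI[of _ y] bexI[of _ 0]) (simp_all add: dg_module_simps[OF M])
qed blast

lemma bij_quasi_iso: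
  assumes M: "dg_module A M" and f: "dg_map A M N f"
    and bij: "\<And>m. bij_betw (f m) (car M m) (car N m)"
  shows "quasi_iso A M N f"
  using quasi_iso_compose_bij[OF M M quasi_iso_id[OF M] f bij] .

lemma quasi_iso_compose:
  assumes M: "dg_module A M" and N: "dg_module A N" and L: "dg_module A L"
    and f: "quasi_iso A M N f" and g: "quasi_iso A N L g"
  shows "quasi_iso A M L (\<lambda>m x. g m (f m x))"
  unfolding quasi_iso_def
proof (intro conjI allI ballI impI; (elim conjE bexE)?)
  note f' = dg_map_simps[OF M quasi_iso_dg_map[OF f]]
  note g' = dg_map_simps[OF N quasi_iso_dg_map[OF g]]
  show "dg_map A M L (\<lambda>m x. g m (f m x))"
    by (intro dg_mapI) (simp_all add: f' g')
  fix m
  {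
    fix x y
    assume x: "x \<in> car M m" "dif M m x = 0"
      and y: "y \<in> car L (m + 1)" "g m (f m x) = dif L (m + 1) y"
    have "f m x \<in> car N m" "dif N m (f m x) = 0"
      using x f'(7)[of x m "m - 1", symmetric] by (simp_all add: f')
    then obtain z where "z \<in> car N (m + 1)" "f m x = dif N (m + 1) z"
      using quasi_iso_inj[OF g] y by blast
    then show "\<exists>z\<in>car M (m + 1). x = dif M (m + 1) z"
      using quasi_iso_inj[OF f] x by blast
  }
  {
    fix y
    assume "y \<in> car L m" "dif L m y = 0"
    then obtain x w where x: "x \<in> car N m" "dif N m x = 0" and w: "w \<in> car L (m + 1)"
      and y: "y = g m x + dif L (m + 1) w"
      using quasi_iso_surj[OF g] by blast
    then obtain u v where u: "u \<in> car M m" "dif M m u = 0" and v: "v \<in> car N (m + 1)"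
      and x': "x = f m u + dif N (m + 1) v"
      using quasi_iso_surj[OF f] by blast
    have "g m x = g m (f m u) + dif L (m + 1) (g (m + 1) v)"
      using u v dg_map_dif[OF N quasi_iso_dg_map[OF g], of v "m + 1" m]
      by (simp add: x' g'(6) f'(1) dg_module_dif_car[OF N])
    with y have "y = g m (f m u) + (dif L (m + 1) (g (m + 1) v) + dif L (m + 1) w)"
      by (simp add: algebra_simps)
    with u v w y show "\<exists>x\<in>car M m. \<exists>w\<in>car L (m + 1).
        dif M m x = 0 \<and> y = g m (f m x) + dif L (m + 1) w"
      using dg_map_car[OF N quasi_iso_dg_map[OF g], of v "m + 1"]
      by (intro bexI[of _ u] bexI[of _ "g (m + 1) v + w"]) (simp_all add: dg_module_simps[OF L])
  }
qed

section \<open>Shifts\<close>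

lemma quasi_iso_shift:
  assumes M: "dg_module A M" and N: "dg_module A N" and q: "quasi_iso A M N f"
  shows "quasi_iso A (dg_shift k M) (dg_shift k N) (\<lambda>m. f (m - k))"
  unfolding quasi_iso_def
proof (intro conjI allI ballI impI; (elim conjE bexE)?)
  note f = dg_map_simps[OF M quasi_iso_dg_map[OF q]]
  show "dg_map A (dg_shift k M) (dg_shift k N) (\<lambda>m. f (m - k))"
    by (intro dg_mapI)
      (simp_all add: dg_shift_def f dg_module_dif_car[OF M] dg_module_smul_car[OF M])
  fix m
  {
    fix x y
    assume "x \<in> car (dg_shift k M) m" "dif (dg_shift k M) m x = 0"
      "y \<in> car (dg_shift k N) (m + 1)" "f (m - k) x = dif (dg_shift k N) (m + 1) y"
    then have "x \<in> car M (m - k)" "dif M (m - k) x = 0" "ksign k y \<in> car N (m - k + 1)"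
      "f (m - k) x = dif N (m - k + 1) (ksign k y)"
      by (auto simp: dg_shift_def algebra_simps dg_module_simps[OF N] ksign_eq_0_iff)
    then obtain z where "z \<in> car M (m - k + 1)" "x = dif M (m - k + 1) z"
      using quasi_iso_inj[OF q] by blast
    \<comment> \<open>The shift multiplies the differential by the sign of \<open>k\<close>, so a
      primitive has to be rescaled by the same sign.\<close>
    then show "\<exists>z\<in>car (dg_shift k M) (m + 1). x = dif (dg_shift k M) (m + 1) z"
      by (intro bexI[of _ "ksign k z"])
        (simp_all add: dg_shift_def algebra_simps dg_module_simps[OF M] ksign_ksign)
  }
  {
    fix y
    assume "y \<in> car (dg_shift k N) m" "dif (dg_shift k N) m y = 0"
    then have "y \<in> car N (m - k)" "dif N (m - k) y = 0"
      by (auto simp: dg_shift_def ksign_eq_0_iff)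
    then obtain x w where "x \<in> car M (m - k)" "w \<in> car N (m - k + 1)" "dif M (m - k) x = 0"
      "y = f (m - k) x + dif N (m - k + 1) w"
      using quasi_iso_surj[OF q] by blast
    then show "\<exists>x\<in>car (dg_shift k M) m. \<exists>w\<in>car (dg_shift k N) (m + 1).
        dif (dg_shift k M) m x = 0 \<and> y = f (m - k) x + dif (dg_shift k N) (m + 1) w"
      by (intro bexI[of _ x] bexI[of _ "ksign k w"])
        (simp_all add: dg_shift_def algebra_simps dg_module_simps[OF N] ksign_ksign)
  }
qed

lemma acyclic_shift:
  assumes M: "dg_module A M"
  shows "acyclic (dg_shift k M) \<longleftrightarrow> acyclic M"
proof
  assume M': "acyclic M"
  show "acyclic (dg_shift k M)"
    unfolding acyclic_def
  proof (intro allI ballI impI)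
    fix m x
    assume "x \<in> car (dg_shift k M) m" "dif (dg_shift k M) m x = 0"
    then have "x \<in> car M (m - k)" "dif M (m - k) x = 0"
      by (auto simp: dg_shift_def ksign_eq_0_iff)
    then obtain y where "y \<in> car M (m - k + 1)" "x = dif M (m - k + 1) y"
      using M' unfolding acyclic_def by blast
    then show "\<exists>y\<in>car (dg_shift k M) (m + 1). x = dif (dg_shift k M) (m + 1) y"
      by (intro bexI[of _ "ksign k y"])
        (simp_all add: dg_shift_def algebra_simps dg_module_simps[OF M] ksign_ksign)
  qed
next
  assume M': "acyclic (dg_shift k M)"
  show "acyclic M"
    unfolding acyclic_def
  proof (intro allI ballI impI)
    fix m x
    assume "x \<in> car M m" "dif M m x = 0"
    then have "x \<in> car (dg_shift k M) (m + k)" "dif (dg_shift k M) (m + k) x = 0"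
      by (auto simp: dg_shift_def)
    then obtain y where "y \<in> car (dg_shift k M) (m + k + 1)" "x = dif (dg_shift k M) (m + k + 1) y"
      using M' unfolding acyclic_def by blast
    then show "\<exists>y\<in>car M (m + 1). x = dif M (m + 1) y"
      by (intro bexI[of _ "ksign k y"])
        (simp_all add: dg_shift_def algebra_simps dg_module_simps[OF M])
  qed
qed

text \<open>The middle entry, one degree higher, is a homotopy: in a cycle \<open>(x, l, y)\<close>
  it satisfies \<open>d l = g x - h y\<close>. The legs are not assumed surjective, so a strict
  fibre product could have the wrong homology.\<close>

definition dg_hpullback :: "('a, 'p::ab_group_add) dgmod \<Rightarrow> ('a, 'l::ab_group_add) dgmod \<Rightarrow>
    ('a, 'n::ab_group_add) dgmod \<Rightarrow> (int \<Rightarrow> 'p \<Rightarrow> 'l) \<Rightarrow> (int \<Rightarrow> 'n \<Rightarrow> 'l) \<Rightarrow> ('a, 'p \<times> 'l \<times> 'n) dgmod" where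
  "dg_hpullback P L N g h =
     \<lparr>car = (\<lambda>m. car P m \<times> car L (m + 1) \<times> car N m),
      dif = (\<lambda>m (x, l, y). (dif P m x, - dif L (m + 1) l + g m x - h m y, dif N m y)),
      smul = (\<lambda>p m a (x, l, y).
        (smul P p m a x, ksign (int p) (smul L p (m + 1) a l), smul N p m a y))\<rparr>"

lemma dg_module_hpullback:
  assumes P: "dg_module A P" and L: "dg_module A L" and N: "dg_module A N"
    and g: "dg_map A P L g" and h: "dg_map A N L h"
  shows "dg_module A (dg_hpullback P L N g h)"
proof (rule dg_moduleI, goal_cases)
  case (9 p q m a b x)
  then show ?case
    using dg_module_smul_shuffle[OF P, of a p b q "fst x" m, OF _ _ _ refl]
      dg_module_smul_shuffle[OF L, of a p b q "fst (snd x)" "m + 1", OF _ _ _ refl]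
      dg_module_smul_shuffle[OF N, of a p b q "snd (snd x)" m, OF _ _ _ refl]
    by (auto simp: dg_hpullback_def dg_module_simps[OF L] dg_module_smul_car[OF L]
      ksign_ksign algebra_simps)
next
  case (10 p m a x)
  then show ?case
    by (auto simp: dg_hpullback_def dg_module_simps[OF P] dg_module_simps[OF L]
      dg_module_simps[OF N] dg_map_simps[OF P g] dg_map_simps[OF N h] ksign_def algebra_simps)
qed (auto simp: dg_hpullback_def add_subgroup_def dg_module_simps[OF P] dg_module_simps[OF L]
    dg_module_simps[OF N] dg_map_simps[OF P g] dg_map_simps[OF N h] ksign_def algebra_simps zero_prod_def)

text \<open>The projection is onto, and its kernel is up to sign a shifted cone of \<open>h\<close>,
  hence acyclic. The proof carries out the corresponding chase on elements.\<close>

lemma hpullback_fst_quasi_iso: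
  assumes P: "dg_module A P" and L: "dg_module A L" and N: "dg_module A N"
    and g: "dg_map A P L g" and h: "quasi_iso A N L h"
  shows "quasi_iso A (dg_hpullback P L N g h) P (\<lambda>m. fst)"
  unfolding quasi_iso_def
proof (intro conjI allI ballI impI; (elim conjE bexE)?)
  note h' = dg_map_simps[OF N quasi_iso_dg_map[OF h]] and g' = dg_map_simps[OF P g]
  show "dg_map A (dg_hpullback P L N g h) P (\<lambda>m. fst)"
    by (intro dg_mapI) (auto simp: dg_hpullback_def)
  fix m
  {
    fix xly z
    assume xly: "xly \<in> car (dg_hpullback P L N g h) m" "dif (dg_hpullback P L N g h) m xly = 0"
      and z: "z \<in> car P (m + 1)" "fst xly = dif P (m + 1) z"
    obtain x l y where [simp]: "xly = (x, l, y)" by (cases xly)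
    have l: "l \<in> car L (m + 1)" and y: "y \<in> car N m" "dif N m y = 0"
      and x: "x = dif P (m + 1) z" and eq: "dif L (m + 1) l = g m x - h m y"
      using xly z by (auto simp: dg_hpullback_def zero_prod_def algebra_simps add_eq_0_iff)
    have "h m y = dif L (m + 1) (g (m + 1) z - l)"
      using l z eq x by (simp add: dg_module_simps[OF L] g' algebra_simps)
    then obtain w where w: "w \<in> car N (m + 1)" "y = dif N (m + 1) w"
      using quasi_iso_inj[OF h y, of "g (m + 1) z - l"] l z by (auto simp: dg_module_simps[OF L] g')
    \<comment> \<open>The homotopy coming from the primitives \<open>z\<close> and \<open>w\<close>
      differs from \<open>l\<close> by a cycle of \<open>L\<close>. Surjectivity of \<open>h\<close>
      on homology absorbs that cycle into a correction \<open>u\<close> of \<open>w\<close> and the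
      new homotopy \<open>v\<close>.\<close>
    have "g (m + 1) z - h (m + 1) w - l \<in> car L (m + 1)"
      "dif L (m + 1) (g (m + 1) z - h (m + 1) w - l) = 0"
      using l z w eq x by (simp_all add: dg_module_simps[OF L] g' h' algebra_simps)
    then obtain u v where u: "u \<in> car N (m + 1)" "dif N (m + 1) u = 0" and v: "v \<in> car L (m + 1 + 1)"
      and uv: "g (m + 1) z - h (m + 1) w - l = h (m + 1) u + dif L (m + 1 + 1) v"
      using quasi_iso_surj[OF h] by blast
    have "xly = dif (dg_hpullback P L N g h) (m + 1) (z, v, w + u)"
      using u v w z x uv by (simp add: dg_hpullback_def dg_module_simps[OF N] h' algebra_simps)
    then show "\<exists>z\<in>car (dg_hpullback P L N g h) (m + 1). xly = dif (dg_hpullback P L N g h) (m + 1) z"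
      using u v w z
      by (intro bexI[of _ "(z, v, w + u)"]) (simp_all add: dg_hpullback_def dg_module_simps[OF N])
  }
  {
    fix x
    assume x: "x \<in> car P m" "dif P m x = 0"
    have "g m x \<in> car L m" "dif L m (g m x) = 0"
      using x g'(7)[of x m "m - 1"] by (simp_all add: g')
    then obtain y l where yl: "y \<in> car N m" "l \<in> car L (m + 1)" "dif N m y = 0"
      "g m x = h m y + dif L (m + 1) l"
      using quasi_iso_surj[OF h] by blast
    show "\<exists>z\<in>car (dg_hpullback P L N g h) m. \<exists>w\<in>car P (m + 1).
        dif (dg_hpullback P L N g h) m z = 0 \<and> x = fst z + dif P (m + 1) w"
      using x yl by (intro bexI[of _ "(x, l, y)"] bexI[of _ 0])
        (simp_all add: dg_hpullback_def dg_module_simps[OF P] zero_prod_def)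
  }
qed

text \<open>By symmetry from the first projection. Exchanging the legs must negate the homotopy,
  because the differential contains the difference \<open>g x - h y\<close>.\<close>

lemma hpullback_snd_quasi_iso:
  assumes P: "dg_module A P" and L: "dg_module A L" and N: "dg_module A N"
    and g: "quasi_iso A P L g" and h: "dg_map A N L h"
  shows "quasi_iso A (dg_hpullback P L N g h) N (\<lambda>m x. snd (snd x))"
proof -
  let ?s = "\<lambda>(m::int) (x, l, y). (y, - l, x)"
  note g' = quasi_iso_dg_map[OF g]
  note simps = dg_module_simps[OF P] dg_module_simps[OF L] dg_module_simps[OF N]
  have "quasi_iso A (dg_hpullback P L N g h) (dg_hpullback N L P h g) ?s"
  proof (rule bij_quasi_iso)
    show "dg_module A (dg_hpullback P L N g h)"
      by (rule dg_module_hpullback[OF P L N g' h])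
    show "dg_map A (dg_hpullback P L N g h) (dg_hpullback N L P h g) ?s"
      by (intro dg_mapI) (auto simp: dg_hpullback_def simps ksign_def)
    show "bij_betw (?s m) (car (dg_hpullback P L N g h) m) (car (dg_hpullback N L P h g) m)" for m
      by (rule bij_betw_byWitness[where f' = "\<lambda>(x, l, y). (y, - l, x)"])
        (auto simp: dg_hpullback_def simps)
  qed
  from quasi_iso_compose[OF dg_module_hpullback[OF P L N g' h] dg_module_hpullback[OF N L P h g'] N
      this hpullback_fst_quasi_iso[OF N L P h g]]
  show ?thesis
    by (simp add: case_prod_beta)
qed

text \<open>The zigzag from \<open>M\<close> back to \<open>P\<close>, on to \<open>L\<close> and
  back to \<open>N\<close> is shortened by pulling back its right half. This is the origin of the
  triple products among the apex types of the theorem.\<close>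

lemma dg_equiv_of_cospan:
  fixes P :: "('a, 'p::ab_group_add) dgmod" and L :: "('a, 'l::ab_group_add) dgmod"
    and N :: "('a, 'n::ab_group_add) dgmod"
  assumes P: "dg_module A P" and L: "dg_module A L" and N: "dg_module A N" and M: "dg_module A M"
    and f: "quasi_iso A P M f" and g: "quasi_iso A P L g" and h: "quasi_iso A N L h"
  shows "dg_equiv TYPE('p \<times> 'l \<times> 'n) A M N"
  unfolding dg_equiv_def
proof (intro exI conjI)
  show H: "dg_module A (dg_hpullback P L N g h)"
    by (rule dg_module_hpullback[OF P L N quasi_iso_dg_map[OF g] quasi_iso_dg_map[OF h]])
  show "quasi_iso A (dg_hpullback P L N g h) M (\<lambda>m x. f m (fst x))"
    by (rule quasi_iso_compose[OF H P M hpullback_fst_quasi_iso[OF P L N quasi_iso_dg_map[OF g] h] f])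
  show "quasi_iso A (dg_hpullback P L N g h) N (\<lambda>m x. snd (snd x))"
    by (rule hpullback_snd_quasi_iso[OF P L N g quasi_iso_dg_map[OF h]])
qed

lemma dg_equiv_bij:
  assumes M: "dg_module A M" and f: "dg_map A M M' f"
    and bij: "\<And>m. bij_betw (f m) (car M m) (car M' m)" and eq: "dg_equiv T A M N"
  shows "dg_equiv T A M' N"
  using eq quasi_iso_compose_bij[OF _ M _ f bij] unfolding dg_equiv_def by blast


section \<open>Twisted products\<close>

context
  fixes A :: "'a simplicial_ring" and Y :: "('a, 'm::ab_group_add) grdg" and c :: int
  assumes Y: "dg_object c A Y"
begin

lemma dg_object_wgt: "dg_module A (wgt Y n)"
  using Y by (simp add: dg_object_def)

lemma dg_object_eps_car:
  "x \<in> car (wgt Y n) m \<Longrightarrow> n' = n + 1 \<Longrightarrow> m' = m + c \<Longrightarrow> eps Y n m x \<in> car (wgt Y n') m'"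
  using Y by (simp add: dg_object_def)

lemma dg_object_eps_additive: "additive_on (car (wgt Y n) m) (eps Y n m)"
  using Y by (simp add: dg_object_def)

lemma dg_object_eps_eps:
  "x \<in> car (wgt Y n) m \<Longrightarrow> n' = n + 1 \<Longrightarrow> m' = m + c \<Longrightarrow> eps Y n' m' (eps Y n m x) = 0"
  using Y by (simp add: dg_object_def)

lemma dg_object_dif_eps:
  "x \<in> car (wgt Y n) m \<Longrightarrow> n' = n + 1 \<Longrightarrow> m' = m + c \<Longrightarrow>
    dif (wgt Y n') m' (eps Y n m x) = - eps Y n (m - 1) (dif (wgt Y n) m x)"
  using Y by (simp add: dg_object_def)

lemma dg_object_eps_smul:
  "a \<in> carrier (obj A p) \<Longrightarrow> x \<in> car (wgt Y n) m \<Longrightarrow> m' = m + int p \<Longrightarrow>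
    eps Y n m' (smul (wgt Y n) p m a x)
      = ksign (int p) (smul (wgt Y (n + 1)) p (m + c) a (eps Y n m x))"
  using Y by (simp add: dg_object_def)

lemmas dg_object_simps = dg_module_simps[OF dg_object_wgt] dg_object_eps_car
  additive_on_simps[OF dg_module_subgroup[OF dg_object_wgt] dg_object_eps_additive]
  additive_on_add[OF dg_object_eps_additive]
  dg_object_eps_eps dg_object_dif_eps dg_object_eps_smul

end

text \<open>The degree \<open>c\<close> covers both signs: \<open>c = - 1\<close> for comparing
  twisted products, and \<open>c = 1\<close> because gr(X) is itself the cone of such a map.\<close>

definition grdg_map :: "int \<Rightarrow> 'a simplicial_ring \<Rightarrow> ('a, 'm::ab_group_add) grdg \<Rightarrow>
    ('a, 'n::ab_group_add) grdg \<Rightarrow> (int \<Rightarrow> int \<Rightarrow> 'm \<Rightarrow> 'n) \<Rightarrow> bool" where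
  "grdg_map c A Y Z f \<longleftrightarrow> (\<forall>n. dg_map A (wgt Y n) (wgt Z n) (f n)) \<and>
     (\<forall>n m. \<forall>x\<in>car (wgt Y n) m. f (n + 1) (m + c) (eps Y n m x) = eps Z n m (f n m x))"

lemma grdg_map_dg_map: "grdg_map c A Y Z f \<Longrightarrow> dg_map A (wgt Y n) (wgt Z n) (f n)"
  by (simp add: grdg_map_def)

lemma grdg_map_eps:
  "grdg_map c A Y Z f \<Longrightarrow> x \<in> car (wgt Y n) m \<Longrightarrow> n' = n + 1 \<Longrightarrow> m' = m + c \<Longrightarrow>
    f n' m' (eps Y n m x) = eps Z n m (f n m x)"
  by (simp add: grdg_map_def)

lemma DG_minus_quasi_iso_iff:
  "DG_minus_quasi_iso A Y Z f \<longleftrightarrow>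
    grdg_map (- 1) A Y Z f \<and> (\<forall>n. quasi_iso A (wgt Y n) (wgt Z n) (f n))"
  by (auto simp: DG_minus_quasi_iso_def grdg_map_def quasi_iso_dg_map)

definition grdg_cofib :: "('a, 'm::ab_group_add) grdg \<Rightarrow> ('a, 'n::ab_group_add) grdg \<Rightarrow>
    (int \<Rightarrow> int \<Rightarrow> 'm \<Rightarrow> 'n) \<Rightarrow> ('a, 'm \<times> 'n) grdg" where
  "grdg_cofib Y Z f =
     \<lparr>wgt = (\<lambda>n. dg_cofib (wgt Y n) (wgt Z n) (f n)),
      eps = (\<lambda>n m (x, y). (- eps Y n (m - 1) x, eps Z n m y))\<rparr>"

lemma dg_objectI:
  assumes "\<And>n. dg_module A (wgt Y n)"
    and "\<And>n m x. x \<in> car (wgt Y n) m \<Longrightarrow> eps Y n m x \<in> car (wgt Y (n + 1)) (m + c)"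
    and "\<And>n m x y. x \<in> car (wgt Y n) m \<Longrightarrow> y \<in> car (wgt Y n) m \<Longrightarrow>
      eps Y n m (x + y) = eps Y n m x + eps Y n m y"
    and "\<And>n m x. x \<in> car (wgt Y n) m \<Longrightarrow> eps Y (n + 1) (m + c) (eps Y n m x) = 0"
    and "\<And>n m x. x \<in> car (wgt Y n) m \<Longrightarrow>
      dif (wgt Y (n + 1)) (m + c) (eps Y n m x) = - eps Y n (m - 1) (dif (wgt Y n) m x)"
    and "\<And>n p m a x. a \<in> carrier (obj A p) \<Longrightarrow> x \<in> car (wgt Y n) m \<Longrightarrow>
      eps Y n (m + int p) (smul (wgt Y n) p m a x)
        = ksign (int p) (smul (wgt Y (n + 1)) p (m + c) a (eps Y n m x))"
  shows "dg_object c A Y"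
  unfolding dg_object_def additive_on_def by (intro conjI allI ballI; rule assms; assumption)

lemma dg_object_cofib:
  assumes Y: "dg_object c A Y" and Z: "dg_object c A Z" and f: "grdg_map c A Y Z f"
  shows "dg_object c A (grdg_cofib Y Z f)"
proof (rule dg_objectI, goal_cases)
  case (1 n)
  then show ?case
    by (simp add: grdg_cofib_def dg_module_cofib dg_object_wgt[OF Y] dg_object_wgt[OF Z]
      grdg_map_dg_map[OF f])
qed (auto simp: grdg_cofib_def dg_cofib_def dg_object_simps[OF Y] dg_object_simps[OF Z]
    dg_map_simps[OF dg_object_wgt[OF Y] grdg_map_dg_map[OF f]] grdg_map_eps[OF f]
    zero_prod_def algebra_simps ksign_def)

text \<open>Position \<open>(n, m)\<close> of the shear is position \<open>(n, m + 2 * n)\<close> of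
  \<open>Y\<close>. As \<open>m + 2 * n + 1 = (m - 1) + 2 * (n + 1)\<close>, the same operator now
  lowers the degree. All shifts involved are even, so no signs appear.\<close>

lemma DG_minus_shear:
  assumes Y: "DG_plus A Y"
  shows "DG_minus A (shear Y)"
proof (rule dg_objectI, goal_cases)
  case (1 n)
  then show ?case
    by (simp add: shear_def dg_module_shift dg_object_wgt[OF Y])
qed (auto simp: shear_def dg_shift_def dg_object_simps[OF Y] algebra_simps)

lemma DG_minus_gr_bar:
  assumes F: "filtered_module A F"
  shows "DG_minus A (gr_bar F)"
proof -
  have lev: "dg_module A (lev F n)" and trn: "n' = n + 1 \<Longrightarrow> dg_map A (lev F n') (lev F n) (trn F n)"
    for n n' using F by (simp_all add: filtered_module_def)
  show ?thesis
  proof (rule dg_objectI, goal_cases)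
    case (1 n)
    then show ?case
      by (simp add: gr_bar_def fil_gr_def dg_module_cofib lev trn)
  qed (auto simp: gr_bar_def fil_gr_def dg_cofib_def dg_module_simps[OF lev]
      dg_map_simps[OF lev trn] zero_prod_def algebra_simps ksign_def)
qed

text \<open>
  Families \<open>z\<^sub>n \<in> Y\<^sup>n\<close> that vanish below some bound in \<open>I\<close>, with the differential twisted by \<open>\<epsilon>\<close>. The
  sets \<open>I = {i}\<close> give the steps of the brutal filtration, and \<open>I = \<int>\<close> gives its colimit.
\<close>

definition twist :: "int set \<Rightarrow> ('a, 'm::ab_group_add) grdg \<Rightarrow> ('a, int \<Rightarrow> 'm) dgmod" where
  "twist I Y =
     \<lparr>car = (\<lambda>m. {z. (\<forall>n. z n \<in> car (wgt Y n) m) \<and> (\<exists>i\<in>I. \<forall>n<i. z n = 0)}),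
      dif = (\<lambda>m z n. dif (wgt Y n) m (z n) - eps Y (n - 1) m (z (n - 1))),
      smul = (\<lambda>p m a z n. smul (wgt Y n) p m a (z n))\<rparr>"

text \<open>\<open>d - \<epsilon>\<close> squares to zero because \<open>d\<close> and
  \<open>\<epsilon>\<close> anticommute and \<open>\<epsilon>\<close> squares to zero. Sums stay
  bounded below since the smaller of two bounds in \<open>I\<close> is again in
  \<open>I\<close>.\<close>

lemma dg_module_twist:
  assumes Y: "DG_minus A Y" and I: "I \<noteq> {}"
  shows "dg_module A (twist I Y)"
proof (rule dg_moduleI, goal_cases)
  case (1 m)
  have "x - y \<in> car (twist I Y) m" if xy: "x \<in> car (twist I Y) m" "y \<in> car (twist I Y) m" for x y
  proof -
    obtain i j where ij: "i \<in> I" "j \<in> I" "\<forall>n<i. x n = 0" "\<forall>n<j. y n = 0"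
      using xy by (simp add: twist_def) blast
    then have "min i j \<in> I" "\<forall>n<min i j. (x - y) n = 0"
      by (simp_all add: min_def)
    then have "\<exists>i\<in>I. \<forall>n<i. (x - y) n = 0"
      by blast
    with xy show ?thesis
      by (simp add: twist_def dg_object_simps[OF Y])
  qed
  then show ?case
    using I by (auto simp: add_subgroup_def twist_def dg_object_simps[OF Y])
next
  case (2 m x)
  then obtain i where "i \<in> I" "\<forall>n<i. x n = 0"
    by (auto simp: twist_def)
  then have "i \<in> I" "\<forall>n<i. dif (twist I Y) m x n = 0"
    by (simp_all add: twist_def dg_object_simps[OF Y])
  then have "\<exists>i\<in>I. \<forall>n<i. dif (twist I Y) m x n = 0"
    by blast
  with 2 show ?case
    by (simp add: twist_def dg_object_simps[OF Y])
next
  case (5 p m a x)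
  then obtain i where "i \<in> I" "\<forall>n<i. x n = 0"
    by (auto simp: twist_def)
  then have "i \<in> I" "\<forall>n<i. smul (twist I Y) p m a x n = 0"
    using 5 by (simp_all add: twist_def dg_object_simps[OF Y])
  then have "\<exists>i\<in>I. \<forall>n<i. smul (twist I Y) p m a x n = 0"
    by blast
  with 5 show ?case
    by (simp add: twist_def dg_object_simps[OF Y])
next
  case (9 p q m a b x)
  then show ?case
    by (simp add: twist_def dg_module_smul_shuffle[OF dg_object_wgt[OF Y], OF _ _ _ refl])
next
  case (10 p m a x)
  have "eps Y (n - 1) (m + int p) (smul (wgt Y (n - 1)) p m a (x (n - 1)))
      = ksign (int p) (smul (wgt Y n) p (m - 1) a (eps Y (n - 1) m (x (n - 1))))" for n
    using 10 dg_object_eps_smul[OF Y, of a p "x (n - 1)" "n - 1" m, OF _ _ refl]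
    by (simp add: twist_def)
  with 10 show ?case
    by (auto simp: twist_def fun_eq_iff dg_object_simps[OF Y] ksign_def)
qed (auto simp: twist_def fun_eq_iff dg_object_simps[OF Y])

text \<open>A primitive \<open>w\<close> has to satisfy
  \<open>d (w n) = z n + \<epsilon> (w (n - 1))\<close>. These equations are solved upwards from the
  bound \<open>i\<close>, starting from \<open>w n = 0\<close> for \<open>n < i\<close>.\<close>

lemma acyclic_twist:
  assumes Y: "DG_minus A Y" and ac: "\<And>n. acyclic (wgt Y n)"
  shows "acyclic (twist I Y)"
  unfolding acyclic_def
proof (intro allI ballI impI)
  fix m z
  assume z: "z \<in> car (twist I Y) m" "dif (twist I Y) m z = 0"
  obtain i where i: "i \<in> I" and zi: "\<And>n. n < i \<Longrightarrow> z n = 0"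
    using z by (auto simp: twist_def)
  have zn: "z n \<in> car (wgt Y n) m" for n
    using z by (simp add: twist_def)
  have dz: "dif (wgt Y n) m (z n) = eps Y (n - 1) m (z (n - 1))" for n
    using z by (simp add: twist_def fun_eq_iff)
  \<comment> \<open>The clause \<open>\<epsilon> d w = \<epsilon> z\<close> is the invariant of the
    recursion: it makes the next right-hand side a cycle, and it persists because
    \<open>\<epsilon>\<close> kills the correction \<open>\<epsilon> v\<close>. The relation
    \<open>Q\<close> is the equation to be solved.\<close>
  define P where "P k w \<longleftrightarrow> w \<in> car (wgt Y (i + int k)) (m + 1) \<and>
    eps Y (i + int k) m (dif (wgt Y (i + int k)) (m + 1) w) = eps Y (i + int k) m (z (i + int k)) \<and>
    (k = 0 \<longrightarrow> dif (wgt Y i) (m + 1) w = z i)" for k w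
  define Q where "Q k v w \<longleftrightarrow>
    dif (wgt Y (i + int k + 1)) (m + 1) w = z (i + int k + 1) + eps Y (i + int k) (m + 1) v" for k v w
  have "dif (wgt Y i) m (z i) = 0"
    using dz[of i] zi[of "i - 1"] by (simp add: dg_object_simps[OF Y])
  then obtain w where "w \<in> car (wgt Y i) (m + 1)" "z i = dif (wgt Y i) (m + 1) w"
    using ac zn unfolding acyclic_def by blast
  then have "P 0 w"
    by (simp add: P_def)
  moreover have "\<exists>w. P (Suc k) w \<and> Q k v w" if v: "P k v" for k v
  proof -
    let ?n = "i + int k + 1"
    have v': "v \<in> car (wgt Y (?n - 1)) (m + 1)"
      using v by (simp add: P_def)
    then have e: "eps Y (?n - 1) (m + 1) v \<in> car (wgt Y ?n) m"
      by (rule dg_object_eps_car[OF Y]) simp_all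
    have "dif (wgt Y ?n) m (eps Y (?n - 1) (m + 1) v)
        = - eps Y (?n - 1) m (dif (wgt Y (?n - 1)) (m + 1) v)"
      using dg_object_dif_eps[OF Y v', of ?n m] by simp
    then have "dif (wgt Y ?n) m (z ?n + eps Y (?n - 1) (m + 1) v) = 0"
      using v e dz[of ?n] zn[of ?n] by (simp add: P_def dg_module_simps[OF dg_object_wgt[OF Y]])
    moreover have "z ?n + eps Y (?n - 1) (m + 1) v \<in> car (wgt Y ?n) m"
      using e zn[of ?n] by (simp add: dg_module_simps[OF dg_object_wgt[OF Y]])
    ultimately obtain w where w: "w \<in> car (wgt Y ?n) (m + 1)"
      "z ?n + eps Y (?n - 1) (m + 1) v = dif (wgt Y ?n) (m + 1) w"
      using ac[of ?n] unfolding acyclic_def by blast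
    have "eps Y ?n m (dif (wgt Y ?n) (m + 1) w)
        = eps Y ?n m (z ?n) + eps Y ?n m (eps Y (?n - 1) (m + 1) v)"
      unfolding w(2)[symmetric] by (rule additive_on_add[OF dg_object_eps_additive[OF Y] zn e])
    also have "eps Y ?n m (eps Y (?n - 1) (m + 1) v) = 0"
      using v' by (rule dg_object_eps_eps[OF Y]) simp_all
    finally have "P (Suc k) w \<and> Q k v w"
      using w by (simp add: P_def Q_def add.assoc add.commute[of 1])
    then show ?thesis ..
  qed
  \<comment> \<open>Each primitive depends on the one chosen before it, so dependent choice is used;
    index \<open>k\<close> stands for weight \<open>i + k\<close>.\<close>
  ultimately obtain f where f: "\<And>k. P k (f k)" "\<And>k. Q k (f k) (f (Suc k))"
    using dependent_nat_choice[of P Q] by blast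
  define w where "w n = (if n < i then 0 else f (nat (n - i)))" for n
  have w: "w n \<in> car (wgt Y n) (m + 1)" for n
    using f(1)[of "nat (n - i)"]
    by (cases "i \<le> n") (simp_all add: w_def P_def dg_object_simps[OF Y])
  have "z n = dif (wgt Y n) (m + 1) (w n) - eps Y (n - 1) (m + 1) (w (n - 1))" for n
  proof (cases n i rule: linorder_cases)
    case less
    then show ?thesis
      by (simp add: w_def zi dg_object_simps[OF Y])
  next
    case equal
    then show ?thesis
      using f(1)[of 0] by (simp add: w_def P_def dg_object_simps[OF Y])
  next
    case greater
    then have "nat (n - i) = Suc (nat (n - 1 - i))" "i + int (nat (n - 1 - i)) = n - 1"
      by simp_all
    then show ?thesis
      using f(2)[of "nat (n - 1 - i)"] greater by (simp add: w_def Q_def)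
  qed
  moreover have "w \<in> car (twist I Y) (m + 1)"
    using i w by (auto simp: twist_def w_def)
  ultimately show "\<exists>w\<in>car (twist I Y) (m + 1). z = dif (twist I Y) (m + 1) w"
    by (intro bexI[of _ w]) (auto simp: twist_def)
qed

text \<open>After pairing entries, the cone of the induced map is the twisted product of the
  weightwise cones. These are acyclic, so \<open>acyclic_twist\<close> applies.\<close>

lemma twist_quasi_iso:
  assumes Y: "DG_minus A Y" and Z: "DG_minus A Z" and f: "DG_minus_quasi_iso A Y Z f"
    and I: "I \<noteq> {}"
  shows "quasi_iso A (twist I Y) (twist I Z) (\<lambda>m z n. f n m (z n))"
proof (rule acyclic_cofib_imp_quasi_iso)
  have f': "grdg_map (- 1) A Y Z f" and q: "quasi_iso A (wgt Y n) (wgt Z n) (f n)" for n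
    using f by (simp_all add: DG_minus_quasi_iso_iff)
  note f'_simps = dg_map_simps[OF dg_object_wgt[OF Y] grdg_map_dg_map[OF f']]
  show "dg_module A (twist I Y)" "dg_module A (twist I Z)"
    by (fact dg_module_twist[OF Y I] dg_module_twist[OF Z I])+
  show "dg_map A (twist I Y) (twist I Z) (\<lambda>m z n. f n m (z n))"
  proof (rule dg_mapI, goal_cases)
    case (1 m x)
    then obtain i where "i \<in> I" "\<forall>n<i. x n = 0"
      by (auto simp: twist_def)
    with 1 show ?case
      by (auto simp: twist_def f'_simps intro!: bexI[of _ i])
  qed (auto simp: twist_def fun_eq_iff f'_simps grdg_map_eps[OF f'] dg_object_simps[OF Y])
  have C: "DG_minus A (grdg_cofib Y Z f)"
    by (rule dg_object_cofib[OF Y Z f'])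
  have "acyclic (wgt (grdg_cofib Y Z f) n)" for n
    using quasi_iso_imp_acyclic_cofib[OF dg_object_wgt[OF Y] dg_object_wgt[OF Z] q]
    by (simp add: grdg_cofib_def)
  then have ac: "acyclic (twist I (grdg_cofib Y Z f))"
    by (rule acyclic_twist[OF C])
  show "acyclic (dg_cofib (twist I Y) (twist I Z) (\<lambda>m z n. f n m (z n)))"
    unfolding acyclic_def
  proof (intro allI ballI impI)
    fix m xy
    assume xy: "xy \<in> car (dg_cofib (twist I Y) (twist I Z) (\<lambda>m z n. f n m (z n))) m"
      and dxy: "dif (dg_cofib (twist I Y) (twist I Z) (\<lambda>m z n. f n m (z n))) m xy = 0"
    obtain x y where [simp]: "xy = (x, y)" by (cases xy)
    obtain i j where ij: "i \<in> I" "j \<in> I" "\<forall>n<i. x n = 0" "\<forall>n<j. y n = 0"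
      using xy by (simp add: dg_cofib_def twist_def) blast
    then have "min i j \<in> I" "\<forall>n<min i j. (x n, y n) = 0"
      by (simp_all add: min_def zero_prod_def)
    then have "\<exists>i\<in>I. \<forall>n<i. (x n, y n) = 0"
      by blast
    then have "(\<lambda>n. (x n, y n)) \<in> car (twist I (grdg_cofib Y Z f)) m"
      using xy by (simp add: dg_cofib_def twist_def grdg_cofib_def)
    moreover have "dif (twist I (grdg_cofib Y Z f)) m (\<lambda>n. (x n, y n)) = 0"
      using dxy by (auto simp: dg_cofib_def twist_def grdg_cofib_def fun_eq_iff zero_prod_def algebra_simps)
    ultimately obtain w where w: "w \<in> car (twist I (grdg_cofib Y Z f)) (m + 1)"
      "(\<lambda>n. (x n, y n)) = dif (twist I (grdg_cofib Y Z f)) (m + 1) w"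
      using ac unfolding acyclic_def by blast
    define u v where "u n = fst (w n)" and "v n = snd (w n)" for n
    have [simp]: "w n = (u n, v n)" for n
      by (simp add: u_def v_def)
    show "\<exists>z\<in>car (dg_cofib (twist I Y) (twist I Z) (\<lambda>m z n. f n m (z n))) (m + 1).
        xy = dif (dg_cofib (twist I Y) (twist I Z) (\<lambda>m z n. f n m (z n))) (m + 1) z"
      using w by (intro bexI[of _ "(u, v)"])
        (auto simp: dg_cofib_def twist_def grdg_cofib_def fun_eq_iff zero_prod_def algebra_simps)
  qed
qed



section \<open>The filtered circle\<close>

text \<open>Forgetting the transition maps and reading the filtration level as a weight turns
  \<open>X\<close> into an object to which the rules for \<open>dg_object\<close> apply.\<close>

definition circle_grdg :: "('a, 'm::ab_group_add) circle_fildg \<Rightarrow> ('a, 'm) grdg" where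
  "circle_grdg X = \<lparr>wgt = lev X, eps = circle_eps X\<rparr>"

lemma T_fil_epsilon: "(0, 1) \<in> T_fil 1 1"
  by (simp add: T_fil_def postnikov_def circle_car_def circle_dif_def)

lemma T_fil_0: "(0, 0) \<in> T_fil j k"
  by (auto simp: T_fil_def postnikov_def circle_car_def circle_dif_def zero_prod_def)

context
  fixes A :: "'a simplicial_ring" and X :: "('a, 'x::ab_group_add) circle_fildg"
  assumes X: "filtered_circle_module A X"
begin

lemma circle_filtered_module: "filtered_module A X"
  using X unfolding filtered_circle_module_def by (elim conjE)

lemma circle_lev: "dg_module A (lev X n)"
  using circle_filtered_module by (simp add: filtered_module_def)

lemma circle_trn: "n' = n + 1 \<Longrightarrow> dg_map A (lev X n') (lev X n) (trn X n)"
  using circle_filtered_module by (simp add: filtered_module_def)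

text \<open>Additivity in the circle variable. It turns the relations
  \<open>\<epsilon>\<^sup>2 = 0\<close> and \<open>d \<epsilon> = 0\<close> of the circle into
  relations on \<open>X\<close>.\<close>

lemma tact_0:
  assumes "x \<in> car (lev X n) m"
  shows "tact X j k (0, 0) n m x = 0"
proof -
  have "additive_on (T_fil j k) (\<lambda>t. tact X j k t n m x)"
    using X assms unfolding filtered_circle_module_def by (elim conjE) blast
  from additive_on_add[OF this T_fil_0 T_fil_0] show ?thesis
    by simp
qed

lemma circle_eps_trn:
  assumes x: "x \<in> car (lev X n') m" and n': "n' = n + 1" and m': "m' = m + 1"
  shows "trn X n' m' (circle_eps X n' m x) = circle_eps X n m (trn X n m x)"
proof -
  have "\<forall>j k n m. \<forall>t\<in>T_fil j k. \<forall>x\<in>car (lev X (n + 1)) m.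
      trn X (n + j) (m + k) (tact X j k t (n + 1) m x) = tact X j k t n m (trn X n m x)"
    using X unfolding filtered_circle_module_def by (elim conjE)
  then show ?thesis
    using T_fil_epsilon x unfolding circle_eps_def n' m' by blast
qed

lemma DG_plus_circle_grdg: "DG_plus A (circle_grdg X)"
proof (rule dg_objectI, goal_cases)
  case (1 n)
  then show ?case
    by (simp add: circle_grdg_def circle_lev)
next
  case (2 n m x)
  have "\<forall>j k n m. \<forall>t\<in>T_fil j k. \<forall>x\<in>car (lev X n) m.
      tact X j k t n m x \<in> car (lev X (n + j)) (m + k)"
    using X unfolding filtered_circle_module_def by (elim conjE)
  then show ?case
    using 2 T_fil_epsilon by (simp add: circle_grdg_def circle_eps_def)
next
  case (3 n m x y)
  have "\<forall>j k n m. \<forall>t\<in>T_fil j k. additive_on (car (lev X n) m) (tact X j k t n m)"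
    using X unfolding filtered_circle_module_def by (elim conjE)
  then show ?case
    using 3 T_fil_epsilon by (simp add: circle_grdg_def circle_eps_def additive_on_def)
next
  case (4 n m x)
  have x: "x \<in> car (lev X n) m"
    using 4 by (simp add: circle_grdg_def)
  have "\<forall>i h j k n m. \<forall>s\<in>T_fil i h. \<forall>t\<in>T_fil j k. \<forall>x\<in>car (lev X n) m.
      tact X (i + j) (h + k) (circle_mult s t) n m x
        = tact X i h s (n + j) (m + k) (tact X j k t n m x)"
    using X unfolding filtered_circle_module_def by (elim conjE)
  then have "tact X (1 + 1) (1 + 1) (circle_mult (0, 1) (0, 1)) n m x
      = tact X 1 1 (0, 1) (n + 1) (m + 1) (tact X 1 1 (0, 1) n m x)"
    using x T_fil_epsilon by blast
  then show ?case
    using x by (simp add: circle_grdg_def circle_eps_def circle_mult_def tact_0)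
next
  case (5 n m x)
  have "\<forall>j k n m. \<forall>t\<in>T_fil j k. \<forall>x\<in>car (lev X n) m.
      dif (lev X (n + j)) (m + k) (tact X j k t n m x)
        = tact X j (k - 1) (circle_dif k t) n m x
          + ksign k (tact X j k t n (m - 1) (dif (lev X n) m x))"
    using X unfolding filtered_circle_module_def by (elim conjE)
  then have "dif (lev X (n + 1)) (m + 1) (tact X 1 1 (0, 1) n m x)
      = tact X 1 0 (0, 0) n m x + ksign 1 (tact X 1 1 (0, 1) n (m - 1) (dif (lev X n) m x))"
    using 5 T_fil_epsilon by (force simp: circle_grdg_def circle_dif_def zero_prod_def)
  then show ?case
    using 5 by (simp add: circle_grdg_def circle_eps_def tact_0 ksign_def)
next
  case (6 n p m a x)
  have "\<forall>j k n p m. \<forall>t\<in>T_fil j k. \<forall>a\<in>carrier (obj A p). \<forall>x\<in>car (lev X n) m.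
      tact X j k t n (m + int p) (smul (lev X n) p m a x)
        = ksign (k * int p) (smul (lev X (n + j)) p (m + k) a (tact X j k t n m x))"
    using X unfolding filtered_circle_module_def by (elim conjE)
  then have "tact X 1 1 (0, 1) n (m + int p) (smul (lev X n) p m a x)
      = ksign (1 * int p) (smul (lev X (n + 1)) p (m + 1) a (tact X 1 1 (0, 1) n m x))"
    using 6 T_fil_epsilon unfolding circle_grdg_def by auto
  then show ?case
    by (simp add: circle_grdg_def circle_eps_def)
qed

lemmas circle_simps = circle_lev dg_object_simps[OF DG_plus_circle_grdg, unfolded circle_grdg_def grdg.simps]
  dg_map_simps[OF circle_lev circle_trn] circle_eps_trn

text \<open>The transition maps commute with \<open>\<epsilon>\<close>, so they form a map to
  \<open>X\<close> from its copy \<open>?U\<close> reindexed by one, and gr(X) is the cone of that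
  map, including the sign of \<open>eps\<close>.\<close>

lemma DG_plus_gr_plus: "DG_plus A (gr_plus X)"
proof -
  let ?U = "\<lparr>wgt = \<lambda>n. lev X (n + 1), eps = \<lambda>n. circle_eps X (n + 1)\<rparr>"
  have "DG_plus A ?U"
    by (rule dg_objectI) (simp_all add: circle_simps)
  moreover have "grdg_map 1 A ?U (circle_grdg X) (trn X)"
    by (simp add: grdg_map_def circle_grdg_def circle_trn circle_eps_trn)
  ultimately have "DG_plus A (grdg_cofib ?U (circle_grdg X) (trn X))"
    by (rule dg_object_cofib[OF _ DG_plus_circle_grdg])
  then show ?thesis
    by (simp add: grdg_cofib_def circle_grdg_def gr_plus_def fil_gr_def[abs_def])
qed

end



section \<open>Complete filtered objects\<close>

lemma dg_module_prod:
  assumes M: "\<And>n. dg_module A (M n)"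
  shows "dg_module A (dg_prod M)"
proof (rule dg_moduleI, goal_cases)
  case (9 p q m a b x)
  then show ?case
    by (simp add: dg_prod_def dg_module_smul_shuffle[OF M, OF _ _ _ refl])
qed (auto simp: dg_prod_def add_subgroup_def fun_eq_iff dg_module_simps[OF M] ksign_def)

text \<open>With \<open>z n = (p n, q n)\<close> the differential has components
  \<open>- d (p n)\<close> and \<open>d (q n) + trn (p n) - p (n - 1)\<close>. Up to sign and a
  reindexing of \<open>p\<close> by one, this is the cone of \<open>1 - trn\<close>, which computes
  limits on products and colimits on sums.\<close>

lemma twist_gr_bar_car:
  "z \<in> car (twist I (gr_bar F)) m \<longleftrightarrow>
    (\<forall>n. fst (z n) \<in> car (lev F (n + 1)) (m - 1) \<and> snd (z n) \<in> car (lev F n) m) \<and>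
    (\<exists>i\<in>I. \<forall>n<i. z n = 0)"
  by (auto simp: twist_def gr_bar_def fil_gr_def dg_cofib_def mem_Times_iff)

lemma twist_gr_bar_dif:
  "dif (twist I (gr_bar F)) m z = (\<lambda>n. (- dif (lev F (n + 1)) (m - 1) (fst (z n)),
    dif (lev F n) m (snd (z n)) + trn F n (m - 1) (fst (z n)) - fst (z (n - 1))))"
  by (auto simp: twist_def gr_bar_def fil_gr_def dg_cofib_def case_prod_beta)

lemma twist_gr_bar_smul:
  "smul (twist I (gr_bar F)) p m a z = (\<lambda>n. (ksign (int p) (smul (lev F (n + 1)) p (m - 1) a (fst (z n))),
    smul (lev F n) p m a (snd (z n))))"
  by (auto simp: twist_def gr_bar_def fil_gr_def dg_cofib_def case_prod_beta)

lemmas twist_gr_bar = twist_gr_bar_car twist_gr_bar_dif twist_gr_bar_smul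

context
  fixes A :: "'a simplicial_ring" and F :: "('a, 'f::ab_group_add) fildg"
  assumes F: "filtered_module A F"
begin

lemma filtered_lev: "dg_module A (lev F n)"
  using F by (simp add: filtered_module_def)

lemma filtered_trn: "n' = n + 1 \<Longrightarrow> dg_map A (lev F n') (lev F n) (trn F n)"
  using F by (simp add: filtered_module_def)

lemmas filtered_simps = dg_module_simps[OF filtered_lev] dg_map_simps[OF filtered_lev filtered_trn]

lemma dg_map_one_minus_trn: "dg_map A (dg_prod (lev F)) (dg_prod (lev F)) (one_minus_trn F)"
  by (intro dg_mapI) (auto simp: dg_prod_def one_minus_trn_def fun_eq_iff filtered_simps)

lemma complete_filtered_iff:
  "complete_filtered A F \<longleftrightarrow>
    acyclic (dg_cofib (dg_prod (lev F)) (dg_prod (lev F)) (one_minus_trn F))"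
  using F dg_module_cofib[OF dg_module_prod dg_module_prod dg_map_one_minus_trn, OF filtered_lev filtered_lev]
  by (simp add: complete_filtered_def fil_lim_def acyclic_shift)

lemma extend_cycle_down:
  assumes x: "x \<in> car (lev F j) m" "dif (lev F j) m x = 0"
  obtains s where "s j = x" "\<And>n. n \<le> j \<Longrightarrow> s n \<in> car (lev F n) m"
    "\<And>n. n \<le> j \<Longrightarrow> dif (lev F n) m (s n) = 0" "\<And>n. n < j \<Longrightarrow> s n = trn F n m (s (n + 1))"
proof -
  \<comment> \<open>\<open>r k\<close> is the image of \<open>x\<close> at level
    \<open>j - k\<close>.\<close>
  define r where "r = rec_nat x (\<lambda>k. trn F (j - int (Suc k)) m)"
  have r: "r k \<in> car (lev F (j - int k)) m \<and> dif (lev F (j - int k)) m (r k) = 0" for k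
  proof (induction k)
    case 0
    show ?case
      using x by (simp add: r_def)
  next
    case (Suc k)
    let ?n = "j - int (Suc k)"
    have rk: "r k \<in> car (lev F (?n + 1)) m" "dif (lev F (?n + 1)) m (r k) = 0"
      using Suc by simp_all
    have "r (Suc k) = trn F ?n m (r k)"
      by (simp add: r_def)
    then show ?case
      using rk dg_map_dif[OF filtered_lev filtered_trn, of "?n + 1" ?n "r k" m "m - 1"]
      by (simp add: filtered_simps)
  qed
  show thesis
  proof (rule that[of "\<lambda>n. r (nat (j - n))"])
    show "r (nat (j - j)) = x"
      by (simp add: r_def)
    fix n
    {
      assume "n \<le> j"
      then show "r (nat (j - n)) \<in> car (lev F n) m" "dif (lev F n) m (r (nat (j - n))) = 0"
        using r[of "nat (j - n)"] by simp_all
    }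
    assume "n < j"
    then have "nat (j - n) = Suc (nat (j - (n + 1)))" "n = j - int (Suc (nat (j - (n + 1))))"
      by simp_all
    then show "r (nat (j - n)) = trn F n m (r (nat (j - (n + 1))))"
      by (simp add: r_def)
  qed
qed

text \<open>
  A cycle in the limit over the levels \<open>n \<ge> j\<close> extends to the levels below \<open>j\<close> along the
  transition maps.
\<close>

lemma complete_tail:
  assumes complete: "complete_filtered A F"
    and a: "\<And>n. n \<ge> j \<Longrightarrow> a n \<in> car (lev F n) (m - 1)" "\<And>n. n \<ge> j \<Longrightarrow> dif (lev F n) (m - 1) (a n) = 0"
    and b: "\<And>n. n \<ge> j \<Longrightarrow> b n \<in> car (lev F n) m"
      "\<And>n. n \<ge> j \<Longrightarrow> dif (lev F n) m (b n) + a n - trn F n (m - 1) (a (n + 1)) = 0"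
  obtains u v where "\<And>n. n \<ge> j \<Longrightarrow> u n \<in> car (lev F n) m" "\<And>n. n \<ge> j \<Longrightarrow> v n \<in> car (lev F n) (m + 1)"
    "\<And>n. n \<ge> j \<Longrightarrow> a n = - dif (lev F n) m (u n)"
    "\<And>n. n \<ge> j \<Longrightarrow> b n = dif (lev F n) (m + 1) (v n) + u n - trn F n m (u (n + 1))"
proof -
  let ?C = "dg_cofib (dg_prod (lev F)) (dg_prod (lev F)) (one_minus_trn F)"
  obtain s where s: "s j = a j" "\<And>n. n \<le> j \<Longrightarrow> s n \<in> car (lev F n) (m - 1)"
    "\<And>n. n \<le> j \<Longrightarrow> dif (lev F n) (m - 1) (s n) = 0" "\<And>n. n < j \<Longrightarrow> s n = trn F n (m - 1) (s (n + 1))"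
    using extend_cycle_down[OF a(1)[of j] a(2)[of j]] by auto
  define a' where "a' n = (if n < j then s n else a n)" for n
  \<comment> \<open>Below \<open>j\<close> the extension satisfies
    \<open>a' n = trn (a' (n + 1))\<close> exactly, so zero is the right continuation of
    \<open>b\<close>. The primitive found on all levels is then used only for
    \<open>n \<ge> j\<close>, where the equations involve only levels from \<open>j\<close>
    on.\<close>
  define b' where "b' n = (if n < j then 0 else b n)" for n
  have "a' n \<in> car (lev F n) (m - 1)" "dif (lev F n) (m - 1) (a' n) = 0" "b' n \<in> car (lev F n) m" for n
    using s(2,3)[of n] a[of n] b(1)[of n] by (simp_all add: a'_def b'_def filtered_simps)
  moreover have "dif (lev F n) m (b' n) + (a' n - trn F n (m - 1) (a' (n + 1))) = 0" for n
  proof (cases "n < j")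
    case True
    then have "a' (n + 1) = s (n + 1)"
      using s(1) by (cases "n + 1 = j") (simp_all add: a'_def)
    with True s(4)[OF True] show ?thesis
      by (simp add: a'_def b'_def filtered_simps)
  next
    case False
    then show ?thesis
      using b(2)[of n] by (simp add: a'_def b'_def add_diff_eq)
  qed
  ultimately have "(a', b') \<in> car ?C m" "dif ?C m (a', b') = 0"
    by (simp_all add: dg_cofib_def dg_prod_def one_minus_trn_def fun_eq_iff zero_prod_def)
  moreover have "acyclic ?C"
    using complete by (simp add: complete_filtered_iff)
  ultimately obtain uv where uv: "uv \<in> car ?C (m + 1)" "(a', b') = dif ?C (m + 1) uv"
    unfolding acyclic_def by blast
  obtain u v where [simp]: "uv = (u, v)"
    by (cases uv)
  have u: "u n \<in> car (lev F n) m" and v: "v n \<in> car (lev F n) (m + 1)"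
    and a': "a' n = - dif (lev F n) m (u n)"
    and b': "b' n = dif (lev F n) (m + 1) (v n) + u n - trn F n m (u (n + 1))" for n
    using uv by (auto simp: dg_cofib_def dg_prod_def one_minus_trn_def)
  show thesis
  proof (rule that[of u v])
    fix n
    assume "n \<ge> j"
    then show "a n = - dif (lev F n) m (u n)"
      "b n = dif (lev F n) (m + 1) (v n) + u n - trn F n m (u (n + 1))"
      using a'[of n] b'[of n] by (simp_all add: a'_def b'_def)
  qed (simp_all add: u v)
qed

text \<open>Modulo the image of \<open>F\<^sup>i\<close>, the components \<open>p (n - 1)\<close>
  and \<open>q n\<close> with \<open>n > i\<close> lie in the same level \<open>n\<close> and form
  the limit cone of the levels above \<open>i\<close>, which \<open>complete_tail\<close> shows to
  be acyclic.\<close>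

lemma lev_twist_quasi_iso:
  assumes complete: "complete_filtered A F"
  shows "quasi_iso A (lev F i) (twist {i} (gr_bar F)) (\<lambda>m y n. if n = i then (0, y) else 0)"
    (is "quasi_iso A _ ?T ?f")
  unfolding quasi_iso_def
proof (intro conjI allI ballI impI; (elim conjE bexE)?)
  show "dg_map A (lev F i) ?T ?f"
    by (intro dg_mapI) (auto simp: twist_gr_bar fun_eq_iff filtered_simps zero_prod_def)
  fix m
  {
    fix y z
    assume y: "y \<in> car (lev F i) m" "dif (lev F i) m y = 0"
      and z: "z \<in> car ?T (m + 1)" "?f m y = dif ?T (m + 1) z"
    define p q where "p n = fst (z n)" and "q n = snd (z n)" for n
    have pq: "p n \<in> car (lev F (n + 1)) m" "q n \<in> car (lev F n) (m + 1)" for n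
      using z by (simp_all add: twist_gr_bar p_def q_def)
    have p0: "p n = 0" if "n < i" for n
      using z that by (simp add: twist_gr_bar p_def)
    have eq: "(if n = i then (0, y) else 0) = (- dif (lev F (n + 1)) m (p n),
        dif (lev F n) (m + 1) (q n) + trn F n m (p n) - p (n - 1))" for n
      using fun_cong[OF z(2), of n] by (simp add: twist_gr_bar p_def q_def)
    have dp: "dif (lev F (n + 1)) m (p n) = 0" for n
      using eq[of n] by (auto simp: zero_prod_def split: if_splits)
    have dq: "dif (lev F n) (m + 1) (q n) + trn F n m (p n) - p (n - 1) = (if n = i then y else 0)" for n
      using eq[of n] by (auto simp: zero_prod_def split: if_splits)
    \<comment> \<open>Shifting the index of \<open>p\<close> puts \<open>p (n - 1)\<close> in level
      \<open>n\<close>; the sign of \<open>q\<close> turns \<open>trn (p n) - p (n - 1)\<close> into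
      the \<open>1 - trn\<close> of the limit cone.\<close>
    obtain u v where u: "\<And>n. n \<ge> i + 1 \<Longrightarrow> u n \<in> car (lev F n) (m + 1)"
      "\<And>n. n \<ge> i + 1 \<Longrightarrow> p (n - 1) = - dif (lev F n) (m + 1) (u n)"
    proof (rule complete_tail[OF complete, of "i + 1" "\<lambda>n. p (n - 1)" "m + 1" "\<lambda>n. - q n"])
      fix n
      assume n: "i + 1 \<le> n"
      show "p (n - 1) \<in> car (lev F n) (m + 1 - 1)" "dif (lev F n) (m + 1 - 1) (p (n - 1)) = 0"
        "- q n \<in> car (lev F n) (m + 1)"
        using pq(1)[of "n - 1"] pq(2)[of n] dp[of "n - 1"] by (simp_all add: filtered_simps)
      show "dif (lev F n) (m + 1) (- q n) + p (n - 1) - trn F n (m + 1 - 1) (p (n + 1 - 1)) = 0"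
        using n dq[of n] pq(2)[of n] by (simp add: filtered_simps algebra_simps)
    qed auto
    have u': "u (i + 1) \<in> car (lev F (i + 1)) (m + 1)" "p i = - dif (lev F (i + 1)) (m + 1) (u (i + 1))"
      using u[of "i + 1"] by simp_all
    \<comment> \<open>Of the contracted tail only \<open>p i\<close> meets level \<open>i\<close>.
      It is a boundary, so its image under \<open>trn\<close> is one too, and hence \<open>y\<close>
      is.\<close>
    have "y = dif (lev F i) (m + 1) (q i) + trn F i m (p i)"
      using dq[of i] p0[of "i - 1"] by simp
    also have "\<dots> = dif (lev F i) (m + 1) (q i - trn F i (m + 1) (u (i + 1)))"
      using u' pq(2)[of i] by (simp add: filtered_simps)
    finally have "y = dif (lev F i) (m + 1) (q i - trn F i (m + 1) (u (i + 1)))" .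
    then show "\<exists>x\<in>car (lev F i) (m + 1). y = dif (lev F i) (m + 1) x"
      by (rule bexI) (use u' pq(2)[of i] in \<open>simp add: filtered_simps\<close>)
  }
  {
    fix z
    assume z: "z \<in> car ?T m" "dif ?T m z = 0"
    define p q where "p n = fst (z n)" and "q n = snd (z n)" for n
    have pq: "p n \<in> car (lev F (n + 1)) (m - 1)" "q n \<in> car (lev F n) m" for n
      using z by (simp_all add: twist_gr_bar p_def q_def)
    have pq0: "p n = 0" "q n = 0" if "n < i" for n
      using z that by (simp_all add: twist_gr_bar p_def q_def)
    have dp: "dif (lev F (n + 1)) (m - 1) (p n) = 0" for n
      using z(2) by (auto simp: twist_gr_bar p_def q_def zero_prod_def fun_eq_iff)
    have dq: "dif (lev F n) m (q n) + trn F n (m - 1) (p n) - p (n - 1) = 0" for n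
      using z(2) by (auto simp: twist_gr_bar p_def q_def zero_prod_def fun_eq_iff)
    obtain u v where uv: "\<And>n. n \<ge> i + 1 \<Longrightarrow> u n \<in> car (lev F n) m"
      "\<And>n. n \<ge> i + 1 \<Longrightarrow> v n \<in> car (lev F n) (m + 1)"
      "\<And>n. n \<ge> i + 1 \<Longrightarrow> p (n - 1) = - dif (lev F n) m (u n)"
      "\<And>n. n \<ge> i + 1 \<Longrightarrow> - q n = dif (lev F n) (m + 1) (v n) + u n - trn F n m (u (n + 1))"
    proof (rule complete_tail[OF complete, of "i + 1" "\<lambda>n. p (n - 1)" m "\<lambda>n. - q n"])
      fix n
      assume n: "i + 1 \<le> n"
      show "p (n - 1) \<in> car (lev F n) (m - 1)" "dif (lev F n) (m - 1) (p (n - 1)) = 0"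
        "- q n \<in> car (lev F n) m"
        using pq(1)[of "n - 1"] pq(2)[of n] dp[of "n - 1"] by (simp_all add: filtered_simps)
      show "dif (lev F n) m (- q n) + p (n - 1) - trn F n (m - 1) (p (n + 1 - 1)) = 0"
        using n dq[of n] pq(2)[of n] by (simp add: filtered_simps algebra_simps)
    qed auto
    have u': "u (n + 1) \<in> car (lev F (n + 1)) m" "p n = - dif (lev F (n + 1)) m (u (n + 1))"
      if "n \<ge> i" for n
      using uv(1,3)[of "n + 1"] that by simp_all
    \<comment> \<open>The boundary of \<open>w\<close> reproduces every component of
      \<open>z\<close> except the second one at \<open>i\<close>, where it gives
      \<open>trn (u (i + 1))\<close> instead of \<open>q i\<close>; \<open>y\<close> is that
      discrepancy.\<close>
    define y where "y = q i - trn F i m (u (i + 1))"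
    define w where "w n = (if n < i then 0 else (u (n + 1), if n = i then 0 else - v n))" for n
    have y: "y \<in> car (lev F i) m" "dif (lev F i) m y = 0"
      using dq[of i] u'[of i] pq(2)[of i] pq0(1)[of "i - 1"]
      by (simp_all add: y_def filtered_simps)
    have w: "w \<in> car ?T (m + 1)"
      using u' uv by (auto simp: twist_gr_bar w_def filtered_simps)
    have zn: "z n = (p n, q n)" for n
      by (simp add: p_def q_def)
    have "z n = (?f m y + dif ?T (m + 1) w) n" for n
    proof -
      consider "n < i" | "n = i" | "n \<ge> i + 1"
        by linarith
      then show ?thesis
      proof cases
        case 1
        then show ?thesis
          by (simp add: zn pq0 twist_gr_bar w_def filtered_simps)
      next
        case 2
        then show ?thesis
          using u'[of i] by (simp add: zn y_def twist_gr_bar w_def filtered_simps)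
      next
        case 3
        have "q n = - (dif (lev F n) (m + 1) (v n) + u n - trn F n m (u (n + 1)))"
          using uv(4)[OF 3] by (metis minus_minus)
        with 3 show ?thesis
          using uv(2)[OF 3] u'[of n] by (simp add: zn twist_gr_bar w_def filtered_simps)
      qed
    qed
    then have "z = ?f m y + dif ?T (m + 1) w"
      by (rule ext)
    with y w show "\<exists>y\<in>car (lev F i) m. \<exists>w\<in>car ?T (m + 1). dif (lev F i) m y = 0
        \<and> z = ?f m y + dif ?T (m + 1) w"
      by blast
  }
qed

end

section \<open>Colimits as mapping telescopes\<close>

lemma finite_support_bound:
  fixes x :: "int \<Rightarrow> 'm::zero"
  assumes "finite {n. x n \<noteq> 0}"
  obtains i j where "\<And>n. n < i \<Longrightarrow> x n = 0" "\<And>n. n \<ge> j \<Longrightarrow> x n = 0"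
proof
  \<comment> \<open>Inserting \<open>0\<close> makes the set nonempty, so that \<open>Min\<close>
    and \<open>Max\<close> are meaningful.\<close>
  let ?S = "insert 0 {n. x n \<noteq> 0}"
  have S: "finite ?S"
    using assms by simp
  show "x n = 0" if "n < Min ?S" for n
    using that Min_le[OF S, of n] by auto
  show "x n = 0" if "n \<ge> Max ?S + 1" for n
    using that Max_ge[OF S, of n] by auto
qed

lemma finite_support_add:
  fixes x y :: "int \<Rightarrow> 'm::group_add"
  assumes "finite {n. x n \<noteq> 0}" "finite {n. y n \<noteq> 0}"
  shows "finite {n. x n + y n \<noteq> 0}" "finite {n. x n \<noteq> y n}"
  by (rule finite_subset[OF _ finite_UnI[OF assms]]; auto)+

lemma finite_support_map:
  fixes x :: "int \<Rightarrow> 'm::zero"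
  assumes "finite {n. x n \<noteq> 0}" "\<And>n. x n = 0 \<Longrightarrow> y n = 0"
  shows "finite {n. y n \<noteq> 0}"
  by (rule finite_subset[OF _ assms(1)]) (use assms(2) in auto)

lemma dg_module_sum:
  assumes M: "\<And>n. dg_module A (M n)"
  shows "dg_module A (dg_sum M)"
proof (rule dg_moduleI, goal_cases)
  case (2 m x)
  then show ?case
    by (auto simp: dg_sum_def dg_module_simps[OF M] intro: finite_support_map[of x])
next
  case (5 p m a x)
  then show ?case
    by (auto simp: dg_sum_def dg_module_simps[OF M] intro: finite_support_map[of x])
next
  case (9 p q m a b x)
  then show ?case
    by (simp add: dg_sum_def dg_module_smul_shuffle[OF M, OF _ _ _ refl])
qed (auto simp: dg_sum_def add_subgroup_def fun_eq_iff finite_support_add dg_module_simps[OF M] ksign_def)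

context
  fixes A :: "'a simplicial_ring" and F :: "('a, 'f::ab_group_add) fildg"
  assumes F: "filtered_module A F"
begin

lemma dg_map_one_minus_trn_sum: "dg_map A (dg_sum (lev F)) (dg_sum (lev F)) (one_minus_trn F)"
proof (rule dg_mapI, goal_cases)
  case (1 m x)
  have "finite {n. x (n + 1) \<noteq> 0}"
    using 1 finite_vimageI[of "{n. x n \<noteq> 0}" "\<lambda>n. n + 1"] by (simp add: dg_sum_def vimage_def inj_def)
  then have "finite {n. trn F n m (x (n + 1)) \<noteq> 0}"
    by (rule finite_support_map) (simp add: filtered_simps[OF F])
  then show ?case
    using 1 by (auto simp: dg_sum_def one_minus_trn_def filtered_simps[OF F] intro: finite_support_add)
qed (auto simp: dg_sum_def one_minus_trn_def fun_eq_iff filtered_simps[OF F])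

lemma dg_module_fil_colim: "dg_module A (fil_colim F)"
  unfolding fil_colim_def
  by (intro dg_module_cofib dg_module_sum dg_map_one_minus_trn_sum filtered_lev[OF F])

lemma fil_colim_car:
  "(x, y) \<in> car (fil_colim F) m \<longleftrightarrow>
    (\<forall>n. x n \<in> car (lev F n) (m - 1) \<and> y n \<in> car (lev F n) m) \<and>
    finite {n. x n \<noteq> 0} \<and> finite {n. y n \<noteq> 0}"
  by (auto simp: fil_colim_def dg_cofib_def dg_sum_def)

lemma fil_colim_dif:
  "dif (fil_colim F) m (x, y) = (\<lambda>n. - dif (lev F n) (m - 1) (x n),
    \<lambda>n. dif (lev F n) m (y n) + x n - trn F n (m - 1) (x (n + 1)))"
  by (auto simp: fil_colim_def dg_cofib_def dg_sum_def one_minus_trn_def fun_eq_iff add_diff_eq)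

lemma fil_colim_smul:
  "smul (fil_colim F) p m a (x, y) = (\<lambda>n. ksign (int p) (smul (lev F n) p (m - 1) a (x n)),
    \<lambda>n. smul (lev F n) p m a (y n))"
  by (auto simp: fil_colim_def dg_cofib_def dg_sum_def ksign_def)

lemmas fil_colim_simps = fil_colim_car fil_colim_dif fil_colim_smul

text \<open>
  The map identifies the telescope with the part of finite support of the twisted product. If
  such an element bounds a family \<open>z\<close>, then completeness lets one replace the tail of \<open>z\<close> by a
  single term.
\<close>

lemma fil_colim_twist_quasi_iso:
  assumes complete: "complete_filtered A F"
  shows "quasi_iso A (fil_colim F) (twist UNIV (gr_bar F)) (\<lambda>m (x, y) n. (- x (n + 1), y n))"
    (is "quasi_iso A _ ?T ?c")
  unfolding quasi_iso_def
proof (intro conjI allI ballI impI; (elim conjE bexE)?)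
  note lev_qi = lev_twist_quasi_iso[OF F complete]
  show "dg_map A (fil_colim F) ?T ?c"
  proof (rule dg_mapI, goal_cases)
    case (1 m xy)
    obtain x y where xy: "xy = (x, y)" by (cases xy)
    obtain i j where "\<And>n. n < i \<Longrightarrow> x n = 0" "\<And>n. n < j \<Longrightarrow> y n = 0"
      using 1 finite_support_bound[of x] finite_support_bound[of y] by (metis xy fil_colim_car)
    then have "\<exists>i. \<forall>n<i. ?c m xy n = 0"
      by (intro exI[of _ "min (i - 1) j"]) (simp add: xy zero_prod_def)
    then show ?case
      using 1 by (auto simp: xy twist_gr_bar fil_colim_simps filtered_simps[OF F])
  qed (auto simp: twist_gr_bar fil_colim_simps filtered_simps[OF F] fun_eq_iff ksign_def)
  fix m
  {
    fix z
    assume z: "z \<in> car ?T m" "dif ?T m z = 0"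
    obtain i where "\<forall>n<i. z n = 0"
      using z by (auto simp: twist_gr_bar)
    \<comment> \<open>A bounded-below cycle already lives in one step of the tower, where it is
      homologous to a single term at weight \<open>i\<close>; that term has finite support.\<close>
    then have "z \<in> car (twist {i} (gr_bar F)) m" "dif (twist {i} (gr_bar F)) m z = 0"
      using z by (simp_all add: twist_gr_bar)
    then obtain y w where y: "y \<in> car (lev F i) m" "dif (lev F i) m y = 0"
      and w: "w \<in> car (twist {i} (gr_bar F)) (m + 1)"
      and eq: "z = (\<lambda>n. if n = i then (0, y) else 0) + dif (twist {i} (gr_bar F)) (m + 1) w"
      using quasi_iso_surj[OF lev_qi] by blast
    show "\<exists>x\<in>car (fil_colim F) m. \<exists>w\<in>car ?T (m + 1). dif (fil_colim F) m x = 0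
        \<and> z = ?c m x + dif ?T (m + 1) w"
    proof (intro bexI conjI)
      let ?y = "(0, \<lambda>n. if n = i then y else 0) :: (int \<Rightarrow> 'f) \<times> (int \<Rightarrow> 'f)"
      show "?y \<in> car (fil_colim F) m" "dif (fil_colim F) m ?y = 0"
        using y by (auto simp: fil_colim_simps filtered_simps[OF F] fun_eq_iff zero_prod_def)
      show "w \<in> car ?T (m + 1)"
        using w by (auto simp: twist_gr_bar)
      show "z = ?c m ?y + dif ?T (m + 1) w"
        unfolding eq by (auto simp: twist_gr_bar fun_eq_iff zero_prod_def)
    qed
  }
  {
    fix xy z
    assume xy: "xy \<in> car (fil_colim F) m" and z: "z \<in> car ?T (m + 1)" "?c m xy = dif ?T (m + 1) z"
    obtain x y where [simp]: "xy = (x, y)" by (cases xy)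
    have fin: "finite {n. x n \<noteq> 0}" "finite {n. y n \<noteq> 0}"
      using xy by (simp_all add: fil_colim_car)
    define p q where "p n = fst (z n)" and "q n = snd (z n)" for n
    have zn: "z n = (p n, q n)" for n
      by (simp add: p_def q_def)
    have pq: "p n \<in> car (lev F (n + 1)) m" "q n \<in> car (lev F n) (m + 1)" for n
      using z by (simp_all add: twist_gr_bar p_def q_def)
    obtain i where "\<forall>n<i. z n = 0"
      using z by (auto simp: twist_gr_bar)
    then have pq0: "p n = 0" "q n = 0" if "n < i" for n
      using that by (simp_all add: p_def q_def)
    have dp: "dif (lev F (n + 1)) m (p n) = x (n + 1)" for n
      using fun_cong[OF z(2), of n] by (simp add: twist_gr_bar p_def)
    have dq: "dif (lev F n) (m + 1) (q n) + trn F n m (p n) - p (n - 1) = y n" for n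
      using fun_cong[OF z(2), of n] by (simp add: twist_gr_bar p_def q_def)
    obtain k l where "\<And>n. n \<ge> k \<Longrightarrow> x n = 0" "\<And>n. n \<ge> l \<Longrightarrow> y n = 0"
      using finite_support_bound[OF fin(1)] finite_support_bound[OF fin(2)] by metis
    then obtain N where N: "\<And>n. n \<ge> N \<Longrightarrow> x n = 0" "\<And>n. n \<ge> N \<Longrightarrow> y n = 0"
      by (metis max.bounded_iff)
    \<comment> \<open>\<open>N\<close> lies beyond the supports of \<open>x\<close> and
      \<open>y\<close>. Cutting \<open>z\<close> off below \<open>N\<close> leaves the single defect
      \<open>p (N - 1)\<close> at weight \<open>N\<close>, which is thus a boundary in the twisted
      product and, by injectivity on homology, already in \<open>F\<^sup>N\<close>.\<close>
    let ?z = "\<lambda>n. if n < N then 0 else z n"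
    have "?z \<in> car (twist {N} (gr_bar F)) (m + 1)"
      using z by (auto simp: twist_gr_bar filtered_simps[OF F])
    moreover have "(\<lambda>n. if n = N then (0, p (N - 1)) else 0) = dif (twist {N} (gr_bar F)) (m + 1) ?z"
    proof
      fix n
      have "dif (lev F (n + 1)) m (p n) = 0" if "n \<ge> N"
        using dp[of n] N(1)[of "n + 1"] that by simp
      moreover have "dif (lev F n) (m + 1) (q n) + trn F n m (p n) = p (n - 1)" if "n \<ge> N"
        using dq[of n] N(2)[of n] that by simp
      ultimately show "(if n = N then (0, p (N - 1)) else 0) = dif (twist {N} (gr_bar F)) (m + 1) ?z n"
        by (auto simp: twist_gr_bar zn filtered_simps[OF F] zero_prod_def)
    qed
    moreover have p: "p (N - 1) \<in> car (lev F N) m" "dif (lev F N) m (p (N - 1)) = 0"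
      using pq(1)[of "N - 1"] dp[of "N - 1"] N(1)[of N] by simp_all
    ultimately obtain e where e: "e \<in> car (lev F N) (m + 1)" "p (N - 1) = dif (lev F N) (m + 1) e"
      using quasi_iso_inj[OF lev_qi p] by blast
    \<comment> \<open>The first component is \<open>- p\<close> moved up by one, hence kept for
      \<open>n \<le> N\<close>, while \<open>q\<close> is kept only for \<open>n < N\<close>. At
      \<open>N\<close> the primitive \<open>e\<close> cancels the remaining
      \<open>p (N - 1)\<close>.\<close>
    define a where "a n = (if n \<le> N then - p (n - 1) else 0)" for n
    define b where "b n = (if n < N then q n else if n = N then e else 0)" for n
    have ab0: "a n = 0" "b n = 0" if "n \<notin> {min i N..N + 1}" for n
      using that pq0(1)[of "n - 1"] pq0(2)[of n] by (auto simp: a_def b_def)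
    have "finite {n. a n \<noteq> 0}" "finite {n. b n \<noteq> 0}"
      using ab0 finite_subset[of "{n. a n \<noteq> 0}" "{min i N..N + 1}"]
        finite_subset[of "{n. b n \<noteq> 0}" "{min i N..N + 1}"] by blast+
    then have "(a, b) \<in> car (fil_colim F) (m + 1)"
      using e pq[of "n - 1" for n] pq(2) by (auto simp: fil_colim_car a_def b_def filtered_simps[OF F])
    moreover have "xy = dif (fil_colim F) (m + 1) (a, b)"
    proof -
      have "x n = - dif (lev F n) m (a n)" for n
        using dp[of "n - 1"] pq(1)[of "n - 1"] N(1)[of n] by (simp add: a_def filtered_simps[OF F])
      moreover have "y n = dif (lev F n) (m + 1) (b n) + a n - trn F n m (a (n + 1))" for n
        using dq[of n] pq(1)[of n] N(2)[of n] e(2)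
        by (cases n N rule: linorder_cases) (simp_all add: a_def b_def filtered_simps[OF F] algebra_simps)
      ultimately show ?thesis
        by (simp add: fil_colim_dif fun_eq_iff)
    qed
    ultimately show "\<exists>z\<in>car (fil_colim F) (m + 1). xy = dif (fil_colim F) (m + 1) z"
      by blast
  }
qed

end


section \<open>Existence of the brutal filtration\<close>

text \<open>The tower of twisted products is an explicit inverse image under \<open>gr_bar\<close>;
  it shows that the quantification over all models \<open>F\<close> in the theorem is not
  vacuous.\<close>

definition brutal_filtration :: "('a, 'm::ab_group_add) grdg \<Rightarrow> ('a, int \<Rightarrow> 'm) fildg" where
  "brutal_filtration Y = \<lparr>lev = (\<lambda>n. twist {n} (shear Y)), trn = (\<lambda>n m z. z)\<rparr>"

lemma add_subgroup_sum:
  assumes S: "add_subgroup S" and x: "\<And>j. j \<in> J \<Longrightarrow> x j \<in> S"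
  shows "sum x J \<in> S"
  using x by (induction J rule: infinite_finite_induct) (auto simp: add_subgroup_closed[OF S])

context
  fixes A :: "'a simplicial_ring" and Z :: "('a, 'm::ab_group_add) grdg"
  assumes Z: "DG_minus A Z"
begin

lemma dg_map_twist_inclusion: "dg_map A (twist {n + 1} Z) (twist {n} Z) (\<lambda>m z. z)"
  by (rule dg_mapI) (auto simp: twist_def)

text \<open>At a fixed weight \<open>k\<close> only the levels \<open>n \<le> k\<close> contribute.
  So \<open>1 - trn\<close> is bijective on the product, and its inverse is the finite sum of the
  entries \<open>y j k\<close> over \<open>n \<le> j \<le> k\<close>.\<close>

lemma twist_tower_complete:
  "complete_filtered A \<lparr>lev = (\<lambda>n. twist {n} Z), trn = (\<lambda>n m z. z)\<rparr>"
proof -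
  let ?F = "\<lparr>lev = (\<lambda>n. twist {n} Z), trn = (\<lambda>n m z. z)\<rparr>"
  let ?P = "dg_prod (lev ?F)"
  have F: "filtered_module A ?F"
    by (simp add: filtered_module_def dg_module_twist[OF Z] dg_map_twist_inclusion)
  have P: "dg_module A ?P"
    by (intro dg_module_prod) (simp add: dg_module_twist[OF Z])
  have carD: "x n k \<in> car (wgt Z k) m" "k < n \<Longrightarrow> x n k = 0" if "x \<in> car ?P m" for x n k m
    using that by (simp_all add: dg_prod_def twist_def)
  have "bij_betw (one_minus_trn ?F m) (car ?P m) (car ?P m)" for m
    unfolding bij_betw_def
  proof
    show "inj_on (one_minus_trn ?F m) (car ?P m)"
    proof (rule inj_onI, intro ext)
      fix x y n k
      assume x: "x \<in> car ?P m" and y: "y \<in> car ?P m"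
        and eq: "one_minus_trn ?F m x = one_minus_trn ?F m y"
      have step: "x n k - x (n + 1) k = y n k - y (n + 1) k" for n
        using fun_cong[OF fun_cong[OF eq], of n k] by (simp add: one_minus_trn_def)
      show "x n k = y n k"
      \<comment> \<open>Downward induction from level \<open>k + 1\<close>, where both families
        vanish at weight \<open>k\<close>.\<close>
      proof (cases "n \<le> k + 1")
        case True
        then show ?thesis
        proof (induction n rule: int_le_induct)
          case base
          show ?case
            using carD(2)[OF x] carD(2)[OF y] by simp
        next
          case (step n)
          then show ?case
            using \<open>x (n - 1) k - x (n - 1 + 1) k = y (n - 1) k - y (n - 1 + 1) k\<close> by simp
        qed
      next
        case False
        then show ?thesis
          using carD(2)[OF x] carD(2)[OF y] by simp
      qed
    qed
    show "one_minus_trn ?F m ` car ?P m = car ?P m"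
    proof
      show "one_minus_trn ?F m ` car ?P m \<subseteq> car ?P m"
        using dg_map_car[OF P dg_map_one_minus_trn[OF F]] by blast
      show "car ?P m \<subseteq> one_minus_trn ?F m ` car ?P m"
      proof
        fix y
        assume y: "y \<in> car ?P m"
        define x where "x n k = (\<Sum>j\<in>{n..k}. y j k)" for n k
        have "x \<in> car ?P m"
          using carD(1)[OF y] dg_module_subgroup[OF dg_object_wgt[OF Z]]
          by (simp add: dg_prod_def twist_def x_def add_subgroup_sum)
        moreover have "y n k = x n k - x (n + 1) k" for n k
        proof (cases "n \<le> k")
          case True
          then have "{n..k} = insert n {n + 1..k}"
            by auto
          then show ?thesis
            by (simp add: x_def)
        next
          case False
          then show ?thesis
            using carD(2)[OF y, of k n] by (simp add: x_def)
        qed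
        ultimately show "y \<in> one_minus_trn ?F m ` car ?P m"
          by (intro image_eqI[of _ _ x]) (auto simp: one_minus_trn_def fun_eq_iff)
      qed
    qed
  qed
  then have "quasi_iso A ?P ?P (one_minus_trn ?F)"
    by (rule bij_quasi_iso[OF P dg_map_one_minus_trn[OF F]])
  then show ?thesis
    unfolding complete_filtered_iff[OF F] by (rule quasi_iso_imp_acyclic_cofib[OF P P])
qed

lemma twist_cofib_car:
  "uv \<in> car (dg_cofib (twist {n + 1} Z) (twist {n} Z) (\<lambda>m z. z)) m \<longleftrightarrow>
    (\<forall>k. fst uv k \<in> car (wgt Z k) (m - 1) \<and> snd uv k \<in> car (wgt Z k) m) \<and>
    (\<forall>k\<le>n. fst uv k = 0) \<and> (\<forall>k<n. snd uv k = 0)"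
  by (cases uv) (auto simp: dg_cofib_def twist_def)

lemma twist_cofib_dif:
  "dif (dg_cofib (twist {n + 1} Z) (twist {n} Z) (\<lambda>m z. z)) m uv =
    (\<lambda>k. eps Z (k - 1) (m - 1) (fst uv (k - 1)) - dif (wgt Z k) (m - 1) (fst uv k),
     \<lambda>k. dif (wgt Z k) m (snd uv k) - eps Z (k - 1) m (snd uv (k - 1)) + fst uv k)"
  by (cases uv) (auto simp: dg_cofib_def twist_def fun_eq_iff)

lemma twist_cofib_smul:
  "smul (dg_cofib (twist {n + 1} Z) (twist {n} Z) (\<lambda>m z. z)) p m a uv =
    (\<lambda>k. ksign (int p) (smul (wgt Z k) p (m - 1) a (fst uv k)),
     \<lambda>k. smul (wgt Z k) p m a (snd uv k))"
  by (cases uv) (auto simp: dg_cofib_def twist_def fun_eq_iff ksign_def)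

text \<open>Placing \<open>z\<close> at weight \<open>n\<close> alone is no chain map, since the
  twist creates \<open>- \<epsilon> z\<close> at weight \<open>n + 1\<close>. The entry
  \<open>\<epsilon> z\<close> in the shifted summand cancels it, and it also matches the
  \<open>eps\<close> of \<open>gr_bar\<close>.\<close>

lemma twist_tower_gr_quasi_iso:
  "quasi_iso A (wgt Z n) (dg_cofib (twist {n + 1} Z) (twist {n} Z) (\<lambda>m z. z))
     (\<lambda>m z. (\<lambda>k. if k = n + 1 then eps Z n m z else 0, \<lambda>k. if k = n then z else 0))"
  (is "quasi_iso A _ ?C ?f")
  unfolding quasi_iso_def
proof (intro conjI allI ballI impI; (elim conjE bexE)?)
  note simps = twist_cofib_car twist_cofib_dif twist_cofib_smul dg_object_simps[OF Z]
  show f: "dg_map A (wgt Z n) ?C ?f"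
    by (rule dg_mapI) (auto simp: simps fun_eq_iff)
  fix m
  {
    fix x uv
    assume uv: "uv \<in> car ?C (m + 1)" "?f m x = dif ?C (m + 1) uv"
    have "x = dif (wgt Z n) (m + 1) (snd uv n)"
      using fun_cong[OF arg_cong[OF uv(2), of snd], of n] uv(1) by (simp add: simps)
    then show "\<exists>z\<in>car (wgt Z n) (m + 1). x = dif (wgt Z n) (m + 1) z"
      using uv(1) by (intro bexI[of _ "snd uv n"]) (simp_all add: simps)
  }
  {
    fix uv
    assume uv: "uv \<in> car ?C m" "dif ?C m uv = 0"
    define u v where "u = fst uv" and "v = snd uv"
    have uv': "uv = (u, v)"
      by (simp add: u_def v_def)
    have u: "u k \<in> car (wgt Z k) (m - 1)" "k \<le> n \<Longrightarrow> u k = 0"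
      and v: "v k \<in> car (wgt Z k) m" "k < n \<Longrightarrow> v k = 0" for k
      using uv by (simp_all add: simps u_def v_def)
    have dv: "dif (wgt Z k) m (v k) - eps Z (k - 1) m (v (k - 1)) + u k = 0" for k
      using uv(2) by (simp add: simps uv' zero_prod_def fun_eq_iff)
    then have u_eq: "u k = eps Z (k - 1) m (v (k - 1)) - dif (wgt Z k) m (v k)" for k
      by (simp add: eq_neg_iff_add_eq_0 add.commute algebra_simps)
    have dvn: "dif (wgt Z n) m (v n) = 0"
      using dv[of n] u(2)[of n] v(2)[of "n - 1"] by (simp add: simps)
    \<comment> \<open>Subtracting the boundary of \<open>(a, 0)\<close> clears \<open>v\<close>
      above weight \<open>n\<close>; the cycle equation \<open>u_eq\<close> then determines
      \<open>u\<close>.\<close>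
    define a where "a k = (if k \<le> n then 0 else v k)" for k
    have a: "(a, 0) \<in> car ?C (m + 1)"
      using v by (simp add: simps a_def)
    have "uv = ?f m (v n) + dif ?C (m + 1) (a, 0)"
    proof -
      have "u k = (if k = n + 1 then eps Z n m (v n) else 0)
          + (eps Z (k - 1) m (a (k - 1)) - dif (wgt Z k) m (a k))" for k
      proof -
        consider "k < n" | "k = n" | "k = n + 1" | "k > n + 1"
          by linarith
        then show ?thesis
          by cases (use u_eq[of k] u(2)[of k] in \<open>simp_all add: a_def simps\<close>)
      qed
      moreover have "v k = (if k = n then v n else 0) + a k" for k
        using v(2)[of k] by (simp add: a_def)
      ultimately show ?thesis
        by (auto simp: simps uv' fun_eq_iff)
    qed
    with a dvn v(1)[of n] show "\<exists>z\<in>car (wgt Z n) m. \<exists>w\<in>car ?C (m + 1).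
        dif (wgt Z n) m z = 0 \<and> uv = ?f m z + dif ?C (m + 1) w"
      by blast
  }
qed

end

lemma brutal_filtration:
  fixes Y :: "('a, 'm::ab_group_add) grdg"
  assumes Y: "DG_plus A Y"
  shows "is_brutal_filtration TYPE('m) A Y (brutal_filtration Y)"
proof -
  let ?Z = "shear Y"
  note Z = DG_minus_shear[OF Y]
  let ?f = "\<lambda>n m z. (\<lambda>k. if k = n + 1 then eps ?Z n m z else 0, \<lambda>k. if k = n then z else 0)"
  have "DG_minus_quasi_iso A ?Z (gr_bar (brutal_filtration Y)) ?f"
    unfolding DG_minus_quasi_iso_def
  proof (intro conjI allI ballI)
    show "quasi_iso A (wgt ?Z n) (wgt (gr_bar (brutal_filtration Y)) n) (?f n)" for n
      using twist_tower_gr_quasi_iso[OF Z] by (simp add: gr_bar_def fil_gr_def brutal_filtration_def)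
    show "?f (n + 1) (m - 1) (eps ?Z n m x) = eps (gr_bar (brutal_filtration Y)) n m (?f n m x)"
      if "x \<in> car (wgt ?Z n) m" for n m x
      using that by (auto simp: gr_bar_def dg_object_simps[OF Z])
  qed
  \<comment> \<open>The second leg of the span is the identity, so the shear itself is the
    apex.\<close>
  moreover have "DG_minus_quasi_iso A ?Z ?Z (\<lambda>n m z. z)"
    by (simp add: DG_minus_quasi_iso_def quasi_iso_id dg_object_wgt[OF Z])
  ultimately have "DG_minus_equiv TYPE('m) A (gr_bar (brutal_filtration Y)) ?Z"
    unfolding DG_minus_equiv_def using Z by blast
  then show ?thesis
    using twist_tower_complete[OF Z] by (simp add: is_brutal_filtration_def brutal_filtration_def)
qed




section \<open>Graded pieces of the fixed points and of the Tate construction\<close>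

context
  fixes A :: "'a simplicial_ring" and X :: "('a, 'x::ab_group_add) circle_fildg" and i :: int
  assumes X: "filtered_circle_module A X"
begin

text \<open>The shift contributes \<open>- 2 * i\<close> to the degree and the shear
  \<open>2 * n\<close>. Weight \<open>n = i + k\<close> therefore sits in degree
  \<open>m + 2 * k\<close>, as the \<open>k\<close>-th cobar coordinate does.\<close>

lemma shifted_twist_car:
  "z \<in> car (dg_shift (2 * i) (twist I (shear (gr_plus X)))) m \<longleftrightarrow>
    (\<forall>n. fst (z n) \<in> car (lev X (n + 1)) (m - 2 * i + 2 * n - 1) \<and>
      snd (z n) \<in> car (lev X n) (m - 2 * i + 2 * n)) \<and> (\<exists>i\<in>I. \<forall>n<i. z n = 0)"
  by (auto simp: dg_shift_def twist_def shear_def gr_plus_def fil_gr_def dg_cofib_def mem_Times_iff)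

lemma shifted_twist_dif:
  "dif (dg_shift (2 * i) (twist I (shear (gr_plus X)))) m z = (\<lambda>n.
    (- dif (lev X (n + 1)) (m - 2 * i + 2 * n - 1) (fst (z n))
       + circle_eps X n (m - 2 * i + 2 * n - 3) (fst (z (n - 1))),
     dif (lev X n) (m - 2 * i + 2 * n) (snd (z n)) + trn X n (m - 2 * i + 2 * n - 1) (fst (z n))
       - circle_eps X (n - 1) (m - 2 * i + 2 * n - 2) (snd (z (n - 1)))))"
  by (auto simp: dg_shift_def twist_def shear_def gr_plus_def fil_gr_def dg_cofib_def case_prod_beta
    algebra_simps)

lemma shifted_twist_smul:
  "smul (dg_shift (2 * i) (twist I (shear (gr_plus X)))) p m a z = (\<lambda>n.
    (ksign (int p) (smul (lev X (n + 1)) p (m - 2 * i + 2 * n - 1) a (fst (z n))),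
     smul (lev X n) p (m - 2 * i + 2 * n) a (snd (z n))))"
  by (auto simp: dg_shift_def twist_def shear_def gr_plus_def fil_gr_def dg_cofib_def case_prod_beta
    algebra_simps)

lemma shifted_twist_mem:
  assumes "z \<in> car (dg_shift (2 * i) (twist I (shear (gr_plus X)))) m"
  shows "n' = n + 1 \<Longrightarrow> m' = m - 2 * i + 2 * n - 1 \<Longrightarrow> fst (z n) \<in> car (lev X n') m'"
    and "n' = n \<Longrightarrow> m' = m - 2 * i + 2 * n \<Longrightarrow> snd (z n) \<in> car (lev X n') m'"
  using assms by (simp_all add: shifted_twist_car)

lemmas shifted_twist = shifted_twist_car shifted_twist_dif shifted_twist_smul


text \<open>The signs turn the differential \<open>d - \<epsilon>\<close> of \<open>twist\<close> into \<open>d + \<epsilon>\<close>.\<close>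

definition unfold_nonneg :: "(int \<Rightarrow> 'x) \<Rightarrow> nat \<Rightarrow> 'x" where
  "unfold_nonneg w k = ksign (int k) (w (i + int k))"

text \<open>The extra one in the index is the filtration shift by \<open>\<omega>\<close>. The sign
  is that of \<open>n - i\<close> for \<open>n = i - k - 1\<close>, so the convention is uniform
  across weight \<open>i\<close>.\<close>

definition unfold_neg :: "(int \<Rightarrow> 'x) \<Rightarrow> nat \<Rightarrow> 'x" where
  "unfold_neg w k = ksign (int k + 1) (w (i - int k - 1))"

lemmas unfold_defs = unfold_nonneg_def unfold_neg_def ksign_def

definition twist_fixed :: "int \<Rightarrow> (int \<Rightarrow> 'x \<times> 'x) \<Rightarrow> (nat \<Rightarrow> 'x) \<times> (nat \<Rightarrow> 'x)" where
  "twist_fixed m z = (unfold_nonneg (fst \<circ> z), unfold_nonneg (snd \<circ> z))"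

text \<open>Weights below \<open>i\<close> become bar coordinates and the others cobar coordinates;
  the norm takes over the role of \<open>\<epsilon>\<close> from weight \<open>i - 1\<close> to
  weight \<open>i\<close>. The first pair belongs to step \<open>i + 1\<close> of the Tate
  filtration, the second to step \<open>i\<close>.\<close>

definition twist_tate :: "int \<Rightarrow> (int \<Rightarrow> 'x \<times> 'x) \<Rightarrow>
    ((nat \<Rightarrow> 'x) \<times> (nat \<Rightarrow> 'x)) \<times> ((nat \<Rightarrow> 'x) \<times> (nat \<Rightarrow> 'x))" where
  "twist_tate m z = ((unfold_neg (fst \<circ> z), unfold_nonneg (fst \<circ> z)),
    (unfold_neg (snd \<circ> z), unfold_nonneg (snd \<circ> z)))"

section \<open>Comparison with the cobar construction for fixed points\<close>

lemma fil_gr_fixed_car: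
  "(g, f) \<in> car (fil_gr (fixed_points X) i) m \<longleftrightarrow>
    (\<forall>k. g k \<in> car (lev X (i + 1 + int k)) (m - 1 + 2 * int k)) \<and>
    (\<forall>k. f k \<in> car (lev X (i + int k)) (m + 2 * int k))"
  by (simp add: fil_gr_def fixed_points_def dg_cofib_def)

lemma fil_gr_fixed_dif:
  "dif (fil_gr (fixed_points X) i) m (g, f) =
    (\<lambda>k. - dif (lev X (i + 1 + int k)) (m - 1 + 2 * int k) (g k)
        - (if k = 0 then 0 else circle_eps X (i + int k) (m - 3 + 2 * int k) (g (k - 1))),
     \<lambda>k. dif (lev X (i + int k)) (m + 2 * int k) (f k)
        + (if k = 0 then 0 else circle_eps X (i + int k - 1) (m - 2 + 2 * int k) (f (k - 1)))
        + trn X (i + int k) (m - 1 + 2 * int k) (g k))"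
  by (auto simp: fil_gr_def fixed_points_def dg_cofib_def fun_eq_iff of_nat_diff algebra_simps)

lemma fil_gr_fixed_smul:
  "smul (fil_gr (fixed_points X) i) p m a (g, f) =
    (\<lambda>k. ksign (int p) (smul (lev X (i + 1 + int k)) p (m - 1 + 2 * int k) a (g k)),
     \<lambda>k. smul (lev X (i + int k)) p (m + 2 * int k) a (f k))"
  by (auto simp: fil_gr_def fixed_points_def dg_cofib_def fun_eq_iff ksign_def)

lemmas fil_gr_fixed = fil_gr_fixed_car fil_gr_fixed_dif fil_gr_fixed_smul

lemma dg_map_twist_fixed:
  "dg_map A (dg_shift (2 * i) (twist {i} (shear (gr_plus X)))) (fil_gr (fixed_points X) i) twist_fixed"
proof (rule dg_mapI, goal_cases)
  case (1 m z)
  note z = shifted_twist_mem[OF 1]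
  show ?case
    by (simp add: twist_fixed_def unfold_defs fil_gr_fixed circle_simps[OF X] z)
next
  case (2 m x y)
  then show ?case
    by (simp add: twist_fixed_def unfold_defs fun_eq_iff)
next
  case (3 m z)
  note z = shifted_twist_mem[OF 3]
  \<comment> \<open>At \<open>k = 0\<close> the twisted differential still refers to weight
    \<open>i - 1\<close>, whereas the cobar differential has no such term.\<close>
  have z0: "z (i - 1) = 0"
    using 3 by (simp add: shifted_twist)
  show ?case
  proof (intro prod_eqI ext)
    fix k
    show "fst (twist_fixed (m - 1) (dif (dg_shift (2 * i) (twist {i} (shear (gr_plus X)))) m z)) k
        = fst (dif (fil_gr (fixed_points X) i) m (twist_fixed m z)) k"
      unfolding shifted_twist_dif by (cases k) (auto simp: twist_fixed_def unfold_defs fil_gr_fixed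
        circle_simps[OF X] z z0 algebra_simps)
    show "snd (twist_fixed (m - 1) (dif (dg_shift (2 * i) (twist {i} (shear (gr_plus X)))) m z)) k
        = snd (dif (fil_gr (fixed_points X) i) m (twist_fixed m z)) k"
      unfolding shifted_twist_dif by (cases k) (auto simp: twist_fixed_def unfold_defs fil_gr_fixed
        circle_simps[OF X] z z0 algebra_simps)
  qed
next
  case (4 p m a z)
  note z = shifted_twist_mem[OF 4(2)]
  show ?case
    unfolding shifted_twist_smul using 4(1) by (auto simp: twist_fixed_def unfold_defs fil_gr_fixed fun_eq_iff
        circle_simps[OF X] z algebra_simps)
qed


lemma bij_twist_fixed:
  "bij_betw (twist_fixed m) (car (dg_shift (2 * i) (twist {i} (shear (gr_plus X)))) m)
    (car (fil_gr (fixed_points X) i) m)"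
proof (rule bij_betw_byWitness[where f' = "\<lambda>(g, f) n. if n < i then 0
    else (ksign (n - i) (g (nat (n - i))), ksign (n - i) (f (nat (n - i))))"], goal_cases)
  case 1
  then show ?case
    by (auto simp: shifted_twist_car twist_fixed_def unfold_defs fun_eq_iff)
next
  case 2
  then show ?case
    by (auto simp: twist_fixed_def unfold_defs fun_eq_iff)
next
  case 3
  then show ?case
    using dg_map_twist_fixed by (auto simp: dg_map_def)
next
  case 4
  have "(\<lambda>n. if n < i then 0 else (ksign (n - i) (g (nat (n - i))), ksign (n - i) (f (nat (n - i)))))
      \<in> car (dg_shift (2 * i) (twist {i} (shear (gr_plus X)))) m"
    if gf: "(g, f) \<in> car (fil_gr (fixed_points X) i) m" for g f
  proof -
    have "g (nat (n - i)) \<in> car (lev X (n + 1)) (m - 2 * i + 2 * n - 1)"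
      "f (nat (n - i)) \<in> car (lev X n) (m - 2 * i + 2 * n)" if "n \<ge> i" for n
      using gf[unfolded fil_gr_fixed_car] that
      by (auto dest!: spec[of _ "nat (n - i)"] simp: algebra_simps)
    then show ?thesis
      by (auto simp: shifted_twist circle_simps[OF X])
  qed
  then show ?case
    by auto
qed

section \<open>Comparison with the Tate construction\<close>

lemma fil_gr_tate_car:
  "((x1, f1), (x0, f0)) \<in> car (fil_gr (tate X) i) m \<longleftrightarrow>
    (\<forall>k. x1 k \<in> car (lev X (i - int k)) (m - 3 - 2 * int k)) \<and> finite {k. x1 k \<noteq> 0} \<and>
    (\<forall>k. f1 k \<in> car (lev X (i + 1 + int k)) (m - 1 + 2 * int k)) \<and>
    (\<forall>k. x0 k \<in> car (lev X (i - 1 - int k)) (m - 2 - 2 * int k)) \<and> finite {k. x0 k \<noteq> 0} \<and>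
    (\<forall>k. f0 k \<in> car (lev X (i + int k)) (m + 2 * int k))"
  by (auto simp: fil_gr_def tate_def omega_tensor_def orbits_def fixed_points_def dg_cofib_def
    dg_shift_def)

text \<open>The entries at \<open>k = 0\<close> in the conditionals come from the norm. In step
  \<open>i\<close> the signs of the shift by \<open>\<omega>\<close> and of the cone of the norm
  cancel on bar coordinates; the first pair carries one more sign, from the graded piece being a
  cone.\<close>

lemma fil_gr_tate_dif:
  "dif (fil_gr (tate X) i) m ((x1, f1), (x0, f0)) =
    ((\<lambda>k. - dif (lev X (i - int k)) (m - 3 - 2 * int k) (x1 k)
         - circle_eps X (i - 1 - int k) (m - 5 - 2 * int k) (x1 (Suc k)),
      \<lambda>k. - dif (lev X (i + 1 + int k)) (m - 1 + 2 * int k) (f1 k)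
         - circle_eps X (i + int k) (m - 3 + 2 * int k) (if k = 0 then x1 0 else f1 (k - 1))),
     (\<lambda>k. dif (lev X (i - 1 - int k)) (m - 2 - 2 * int k) (x0 k)
         + circle_eps X (i - 2 - int k) (m - 4 - 2 * int k) (x0 (Suc k))
         + trn X (i - 1 - int k) (m - 3 - 2 * int k) (x1 k),
      \<lambda>k. dif (lev X (i + int k)) (m + 2 * int k) (f0 k)
         + circle_eps X (i - 1 + int k) (m - 2 + 2 * int k) (if k = 0 then x0 0 else f0 (k - 1))
         + trn X (i + int k) (m - 1 + 2 * int k) (f1 k)))"
  by (auto simp: fil_gr_def tate_def omega_tensor_def orbits_def fixed_points_def norm_map_def
    dg_cofib_def dg_shift_def ksign_def fun_eq_iff of_nat_diff algebra_simps)

lemma fil_gr_tate_smul: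
  "smul (fil_gr (tate X) i) p m a ((x1, f1), (x0, f0)) =
    ((\<lambda>k. ksign (int p) (smul (lev X (i - int k)) p (m - 3 - 2 * int k) a (x1 k)),
      \<lambda>k. ksign (int p) (smul (lev X (i + 1 + int k)) p (m - 1 + 2 * int k) a (f1 k))),
     (\<lambda>k. smul (lev X (i - 1 - int k)) p (m - 2 - 2 * int k) a (x0 k),
      \<lambda>k. smul (lev X (i + int k)) p (m + 2 * int k) a (f0 k)))"
  by (auto simp: fil_gr_def tate_def omega_tensor_def orbits_def fixed_points_def
    dg_cofib_def dg_shift_def ksign_def fun_eq_iff algebra_simps)

lemmas fil_gr_tate = fil_gr_tate_car fil_gr_tate_dif fil_gr_tate_smul

lemma dg_map_twist_tate:
  "dg_map A (dg_shift (2 * i) (twist UNIV (shear (gr_plus X)))) (fil_gr (tate X) i) twist_tate"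
proof (rule dg_mapI, goal_cases)
  case (1 m z)
  note z = shifted_twist_mem[OF 1]
  \<comment> \<open>A lower bound on the weights amounts to finite support of the bar coordinates,
    as orbits demand.\<close>
  obtain j where j: "\<forall>n<j. z n = 0"
    using 1 by (auto simp: shifted_twist)
  have "z (i - int k - 1) = 0" if "k > nat (i - j)" for k
    using j that by auto
  then have "unfold_neg (fst \<circ> z) k = 0" "unfold_neg (snd \<circ> z) k = 0" if "k > nat (i - j)" for k
    using that by (simp_all add: unfold_defs)
  then have "finite {k. unfold_neg (fst \<circ> z) k \<noteq> 0}" "finite {k. unfold_neg (snd \<circ> z) k \<noteq> 0}"
    by (auto intro!: finite_subset[of _ "{..nat (i - j)}"] simp: not_less[symmetric])
  then show ?case
    by (auto simp: twist_tate_def unfold_defs fil_gr_tate circle_simps[OF X] z)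
next
  case (2 m x y)
  then show ?case
    by (simp add: twist_tate_def unfold_defs fun_eq_iff)
next
  case (3 m z)
  note z = shifted_twist_mem[OF 3]
  show ?case
  proof (intro prod_eqI ext)
    fix k
    have trn_uminus: "n' = n \<Longrightarrow> m' = m - 2 * i + 2 * n - 1 \<Longrightarrow>
        trn X n' m' (- fst (z n)) = - trn X n' m' (fst (z n))" for n n' m'
      using z(1)[of "n + 1" n m'] by (simp add: circle_simps[OF X])
    note simps = trn_uminus twist_tate_def unfold_defs fil_gr_tate circle_simps[OF X] z
    show "fst (fst (twist_tate (m - 1) (dif (dg_shift (2 * i) (twist UNIV (shear (gr_plus X)))) m z))) k
        = fst (fst (dif (fil_gr (tate X) i) m (twist_tate m z))) k"
      unfolding shifted_twist_dif by (cases k) (auto simp: simps algebra_simps)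
    show "snd (fst (twist_tate (m - 1) (dif (dg_shift (2 * i) (twist UNIV (shear (gr_plus X)))) m z))) k
        = snd (fst (dif (fil_gr (tate X) i) m (twist_tate m z))) k"
      unfolding shifted_twist_dif by (cases k) (auto simp: simps algebra_simps)
    show "fst (snd (twist_tate (m - 1) (dif (dg_shift (2 * i) (twist UNIV (shear (gr_plus X)))) m z))) k
        = fst (snd (dif (fil_gr (tate X) i) m (twist_tate m z))) k"
      unfolding shifted_twist_dif by (cases k) (auto simp: simps algebra_simps)
    show "snd (snd (twist_tate (m - 1) (dif (dg_shift (2 * i) (twist UNIV (shear (gr_plus X)))) m z))) k
        = snd (snd (dif (fil_gr (tate X) i) m (twist_tate m z))) k"
      unfolding shifted_twist_dif by (cases k) (auto simp: simps algebra_simps)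
  qed
next
  case (4 p m a z)
  note z = shifted_twist_mem[OF 4(2)]
  show ?case
    unfolding shifted_twist_smul using 4(1) by (auto simp: twist_tate_def unfold_defs fil_gr_tate fun_eq_iff
        circle_simps[OF X] z algebra_simps)
qed

lemma bij_twist_tate:
  "bij_betw (twist_tate m) (car (dg_shift (2 * i) (twist UNIV (shear (gr_plus X)))) m)
    (car (fil_gr (tate X) i) m)"
proof (rule bij_betw_byWitness[where f' = "\<lambda>((x1, f1), (x0, f0)) n.
    if n < i then (ksign (i - n) (x1 (nat (i - n - 1))), ksign (i - n) (x0 (nat (i - n - 1))))
    else (ksign (n - i) (f1 (nat (n - i))), ksign (n - i) (f0 (nat (n - i))))"], goal_cases)
  case 1
  then show ?case
    by (auto simp: twist_tate_def unfold_defs fun_eq_iff)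
next
  case 2
  then show ?case
    by (auto simp: twist_tate_def unfold_defs fun_eq_iff)
next
  case 3
  then show ?case
    using dg_map_twist_tate by (auto simp: dg_map_def)
next
  case 4
  have "(\<lambda>n. if n < i then (ksign (i - n) (x1 (nat (i - n - 1))), ksign (i - n) (x0 (nat (i - n - 1))))
        else (ksign (n - i) (f1 (nat (n - i))), ksign (n - i) (f0 (nat (n - i)))))
      \<in> car (dg_shift (2 * i) (twist UNIV (shear (gr_plus X)))) m"
    if xf: "((x1, f1), (x0, f0)) \<in> car (fil_gr (tate X) i) m" for x1 f1 x0 f0
  proof -
    have f: "f1 (nat (n - i)) \<in> car (lev X (n + 1)) (m - 2 * i + 2 * n - 1)"
      "f0 (nat (n - i)) \<in> car (lev X n) (m - 2 * i + 2 * n)" if "n \<ge> i" for n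
      using xf[unfolded fil_gr_tate_car] that
      by (auto dest!: spec[of _ "nat (n - i)"] simp: algebra_simps)
    have x: "x1 (nat (i - n - 1)) \<in> car (lev X (n + 1)) (m - 2 * i + 2 * n - 1)"
      "x0 (nat (i - n - 1)) \<in> car (lev X n) (m - 2 * i + 2 * n)" if "n < i" for n
      using xf[unfolded fil_gr_tate_car] that
      by (auto dest!: spec[of _ "nat (i - n - 1)"] simp: algebra_simps)
    \<comment> \<open>Conversely, both bar families vanish from a common index \<open>K\<close> on,
      so the reassembled family vanishes below \<open>i - K\<close>.\<close>
    have "finite ({k. x1 k \<noteq> 0} \<union> {k. x0 k \<noteq> 0})"
      using xf by (simp add: fil_gr_tate_car)
    then obtain K where "\<And>k. k \<ge> K \<Longrightarrow> x1 k = 0 \<and> x0 k = 0"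
      unfolding finite_nat_set_iff_bounded by (auto simp: not_less[symmetric])
    then have "x1 (nat (i - n - 1)) = 0 \<and> x0 (nat (i - n - 1)) = 0" if "n < i - int K" for n
      using that by simp
    then have "\<exists>j. \<forall>n<j. (if n < i
        then (ksign (i - n) (x1 (nat (i - n - 1))), ksign (i - n) (x0 (nat (i - n - 1))))
        else (ksign (n - i) (f1 (nat (n - i))), ksign (n - i) (f0 (nat (n - i))))) = 0"
      by (intro exI[of _ "i - int K"]) (auto simp: zero_prod_def)
    with f x show ?thesis
      by (auto simp: shifted_twist circle_simps[OF X])
  qed
  then show ?case
    by auto
qed

end

text \<open>A span in DG_- passes to twisted products and is prolonged by \<open>h\<close> on the
  side of \<open>F\<close> and by the bijection \<open>e\<close> on the side of \<open>Y\<close>.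
  The two equivalences of the theorem are the cases \<open>I = {i}\<close> with
  \<open>N = lev F i\<close>, and \<open>I = UNIV\<close> with
  \<open>N = fil_colim F\<close>.\<close>

lemma dg_equiv_twist:
  fixes F :: "('a, 'f::ab_group_add) fildg" and N :: "('a, 'n::ab_group_add) dgmod"
  assumes Y: "DG_minus A Y" and F: "filtered_module A F"
    and eq: "DG_minus_equiv TYPE('p::ab_group_add) A (gr_bar F) Y" and I: "I \<noteq> {}"
    and N: "dg_module A N" and h: "quasi_iso A N (twist I (gr_bar F)) h"
    and e: "dg_map A (dg_shift k (twist I Y)) M e"
    and bij: "\<And>m. bij_betw (e m) (car (dg_shift k (twist I Y)) m) (car M m)"
  shows "dg_equiv TYPE((int \<Rightarrow> 'p) \<times> (int \<Rightarrow> 'f \<times> 'f) \<times> 'n) A M (dg_shift k N)"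
proof -
  note G = DG_minus_gr_bar[OF F]
  obtain P :: "('a, 'p) grdg" and f g where P: "DG_minus A P"
    and f: "DG_minus_quasi_iso A P (gr_bar F) f" and g: "DG_minus_quasi_iso A P Y g"
    using eq unfolding DG_minus_equiv_def by blast
  note twists = dg_module_twist[OF P I] dg_module_twist[OF G I] dg_module_twist[OF Y I]
  have "dg_equiv TYPE((int \<Rightarrow> 'p) \<times> (int \<Rightarrow> 'f \<times> 'f) \<times> 'n) A
      (dg_shift k (twist I Y)) (dg_shift k N)"
    by (rule dg_equiv_of_cospan[OF twists(1,2)[THEN dg_module_shift] dg_module_shift[OF N]
      dg_module_shift[OF twists(3)]
      quasi_iso_shift[OF twists(1,3) twist_quasi_iso[OF P Y g I]]
      quasi_iso_shift[OF twists(1,2) twist_quasi_iso[OF P G f I]]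
      quasi_iso_shift[OF N twists(2) h]])
  then show ?thesis
    by (rule dg_equiv_bij[OF dg_module_shift[OF twists(3)] e bij])
qed

theorem proposition1p2p4:
  fixes A :: "'a simplicial_ring" and X :: "('a, 'x::ab_group_add) circle_fildg"
  assumes "simplicial_cring A" and "filtered_circle_module A X"
  shows "DG_plus A (gr_plus X) \<and>
    (\<exists>F :: ('a, int \<Rightarrow> 'x \<times> 'x) fildg.
       is_brutal_filtration TYPE('x \<times> 'x) A (gr_plus X) F) \<and>
    (\<forall>F :: ('a, 'f::ab_group_add) fildg.
       is_brutal_filtration TYPE('p::ab_group_add) A (gr_plus X) F \<longrightarrow>
       (\<forall>i.
          dg_equiv TYPE((int \<Rightarrow> 'p) \<times> (int \<Rightarrow> 'f \<times> 'f) \<times> 'f) A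
            (fil_gr (fixed_points X) i)
            (dg_shift (2 * i) (lev F i)) \<and>
          dg_equiv TYPE((int \<Rightarrow> 'p) \<times> (int \<Rightarrow> 'f \<times> 'f) \<times> (int \<Rightarrow> 'f) \<times> (int \<Rightarrow> 'f)) A
            (fil_gr (tate X) i)
            (dg_shift (2 * i) (fil_colim F))))"
proof (intro conjI allI impI)
  note X = assms(2) and Y = DG_plus_gr_plus[OF assms(2)]
  note Z = DG_minus_shear[OF Y]
  show "DG_plus A (gr_plus X)"
    by (rule Y)
  show "\<exists>F :: ('a, int \<Rightarrow> 'x \<times> 'x) fildg. is_brutal_filtration TYPE('x \<times> 'x) A (gr_plus X) F"
    using brutal_filtration[OF Y] by blast
  fix F :: "('a, 'f) fildg" and i :: int
  assume "is_brutal_filtration TYPE('p) A (gr_plus X) F"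
  then have complete: "complete_filtered A F" and F: "filtered_module A F"
    and eq: "DG_minus_equiv TYPE('p) A (gr_bar F) (shear (gr_plus X))"
    by (simp_all add: is_brutal_filtration_def complete_filtered_def)
  show "dg_equiv TYPE((int \<Rightarrow> 'p) \<times> (int \<Rightarrow> 'f \<times> 'f) \<times> 'f) A
      (fil_gr (fixed_points X) i) (dg_shift (2 * i) (lev F i))"
    by (rule dg_equiv_twist[OF Z F eq _ filtered_lev[OF F] lev_twist_quasi_iso[OF F complete]
      dg_map_twist_fixed[OF X] bij_twist_fixed[OF X]]) simp
  show "dg_equiv TYPE((int \<Rightarrow> 'p) \<times> (int \<Rightarrow> 'f \<times> 'f) \<times> (int \<Rightarrow> 'f) \<times> (int \<Rightarrow> 'f)) A
      (fil_gr (tate X) i) (dg_shift (2 * i) (fil_colim F))"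
    by (rule dg_equiv_twist[OF Z F eq _ dg_module_fil_colim[OF F] fil_colim_twist_quasi_iso[OF F complete]
      dg_map_twist_tate[OF X] bij_twist_tate[OF X]]) simp
qed

end
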